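(* Let $M^{2n+1}(f,Q,\xi,\eta,g)$ be a weak $\beta$-Kenmotsu manifold with $\beta=\mathrm{const}\neq 0$. Then the $\ast$-Ricci tensor $\mathrm{Ric}^\ast$ and the $\ast$-scalar curvature $r^\ast$ are related to the Ricci tensor by $$\mathrm{Ric}^\ast(X,Y)=\mathrm{Ric}(X,QY)+\beta^2\{(2n-1)\,g(X,QY)+\eta(X)\,\eta(Y)\}$$ for all vector fields $X,Y$ on $M$, and $$r^\ast=\mathrm{trace}(Q\,\mathrm{Ric}^\sharp)+\beta^2\{4n^2+(2n-1)\,\mathrm{trace}\,\widetilde Q\}.$$
   Context: A weak almost contact metric structure on a smooth manifold $M^{2n+1}$ (of dimension $2n+1$, $n\ge 1$) is a set $(f,Q,\xi,\eta,g)$, where $f$ is a $(1,1)$-tensor of rank $2n$, $Q$ is a nonsingular $(1,1)$-tensor, $\xi$ is a vector field, $\eta$ is a 1-form and $g$ is a Riemannian metric, such that $f^2=-Q+\eta\otimes\xi$, $\eta(\xi)=1$, $Q\xi=\xi$ and $g(fX,fY)=g(X,QY)-\eta(X)\eta(Y)$ for all vector fields $X,Y$. It is assumed that the distribution $\mathcal D=\ker\eta$ is $f$-invariant. Set $\widetilde Q=Q-\mathrm{id}$. $M(f,Q,\xi,\eta,g)$ is a weak $\beta$-Kenmotsu manifold (here $\beta$ is a nonzero real constant) if $(\nabla_X f)Y=\beta\{g(fX,Y)\,\xi-\eta(Y)\,fX\}$ for all vector fields $X,Y$, where $\nabla$ is the Levi-Civita connection of $g$. Curvature conventions: $R_{X,Y}Z=\nabla_X\nabla_YZ-\nabla_Y\nabla_XZ-\nabla_{[X,Y]}Z$;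 $\mathrm{Ric}(X,Y)=\mathrm{trace}(Z\mapsto R_{Z,X}Y)$; $\mathrm{Ric}^\sharp$ is the $(1,1)$-tensor with $g(\mathrm{Ric}^\sharp X,Y)=\mathrm{Ric}(X,Y)$. The $\ast$-Ricci tensor is $\mathrm{Ric}^\ast(X,Y)=\tfrac12\,\mathrm{trace}\{Z\mapsto R_{X,fY}fZ\}$ and the $\ast$-scalar curvature is $r^\ast=\mathrm{trace}_g\mathrm{Ric}^\ast=\sum_i\mathrm{Ric}^\ast(e_i,e_i)$ for a local $g$-orthonormal frame $(e_i)$. *)

theory Defs
  imports "HOL-Analysis.Analysis"
begin

section \<open>Smooth maps between Euclidean spaces\<close>

text \<open>
  These notions are meant for open sets only.  All iterated directional derivatives are required
  to exist and to be continuous.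
\<close>

primrec C_k_on :: "nat \<Rightarrow> 'a set \<Rightarrow> ('a::euclidean_space \<Rightarrow> 'b::real_normed_vector) \<Rightarrow> bool" where
  "C_k_on 0 S f \<longleftrightarrow> continuous_on S f"
| "C_k_on (Suc k) S f \<longleftrightarrow>
     (\<forall>x\<in>S. f differentiable (at x)) \<and> (\<forall>v. C_k_on k S (\<lambda>x. frechet_derivative f (at x) v))"

definition smooth_map_on :: "'a set \<Rightarrow> ('a::euclidean_space \<Rightarrow> 'b::real_normed_vector) \<Rightarrow> bool" where
  "smooth_map_on S f \<longleftrightarrow> (\<forall>k. C_k_on k S f)"


section \<open>Smooth manifolds\<close>

text \<open>
  A chart is a pair of its domain and its coordinate map; the values of the coordinate map
  outside the domain are irrelevant.  The manifold is the whole type \<open>'m\<close>, its dimension is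
  \<open>CARD('k)\<close>, and its smooth structure is the one generated by an atlas, which need not be maximal.
\<close>

type_synonym ('m, 'k) chart = "'m set \<times> ('m \<Rightarrow> real ^ 'k)"

definition chart_inv :: "('m, 'k) chart \<Rightarrow> real ^ 'k \<Rightarrow> 'm" where
  "chart_inv c = inv_into (fst c) (snd c)"

definition is_chart :: "('m::topological_space, 'k::finite) chart \<Rightarrow> bool" where
  "is_chart c \<longleftrightarrow> open (fst c) \<and> open (snd c ` fst c) \<and>
     homeomorphism (fst c) (snd c ` fst c) (snd c) (chart_inv c)"

locale smooth_manifold =
  fixes A :: "('m::{t2_space, second_countable_topology}, 'k::finite) chart set"
  assumes charts: "c \<in> A \<Longrightarrow> is_chart c"
    and cover: "(\<Union>c\<in>A. fst c) = UNIV"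
    and compatible: "c \<in> A \<Longrightarrow> d \<in> A \<Longrightarrow>
      smooth_map_on (snd c ` (fst c \<inter> fst d)) (snd d \<circ> chart_inv c)"

text \<open>
  Every point gets a preferred chart from the atlas, and the tangent space at \<open>p\<close> is identified
  with \<open>real ^ 'k\<close> by means of the coordinate basis of the preferred chart at \<open>p\<close>.  Hence
  a vector field has type \<open>'m \<Rightarrow> real ^ 'k\<close>, and a tensor field assigns to each \<open>p\<close> a multilinear
  map on \<open>real ^ 'k\<close>.  As the preferred chart may jump from point to point, smoothness of a
  vector field is tested on its components in the charts of the atlas.  The Euclidean inner product
  of \<open>real ^ 'k\<close> plays no role.
\<close>

definition chart_at :: "('m, 'k) chart set \<Rightarrow> 'm \<Rightarrow> ('m, 'k) chart" where
  "chart_at A p = (SOME c. c \<in> A \<and> p \<in> fst c)"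

text \<open>The differential of the coordinate map of \<open>c\<close> at \<open>p\<close>, as a map from the tangent space at \<open>p\<close>.\<close>

definition chart_diff ::
  "('m, 'k::finite) chart set \<Rightarrow> ('m, 'k) chart \<Rightarrow> 'm \<Rightarrow> real ^ 'k \<Rightarrow> real ^ 'k" where
  "chart_diff A c p =
     frechet_derivative (snd c \<circ> chart_inv (chart_at A p)) (at (snd (chart_at A p) p))"

text \<open>The component functions of a vector field in the chart \<open>c\<close>.\<close>

definition vf_rep ::
  "('m, 'k::finite) chart set \<Rightarrow> ('m, 'k) chart \<Rightarrow> ('m \<Rightarrow> real ^ 'k) \<Rightarrow> real ^ 'k \<Rightarrow> real ^ 'k" where
  "vf_rep A c X = (\<lambda>x. chart_diff A c (chart_inv c x) (X (chart_inv c x)))"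

definition smooth_fun :: "('m, 'k::finite) chart set \<Rightarrow> ('m \<Rightarrow> real) \<Rightarrow> bool" where
  "smooth_fun A h \<longleftrightarrow> (\<forall>c\<in>A. smooth_map_on (snd c ` fst c) (h \<circ> chart_inv c))"

definition vector_fields :: "('m, 'k::finite) chart set \<Rightarrow> ('m \<Rightarrow> real ^ 'k) set" where
  "vector_fields A = {X. \<forall>c\<in>A. smooth_map_on (snd c ` fst c) (vf_rep A c X)}"

text \<open>The derivative \<open>X h\<close> of a function along a vector field.\<close>

definition dir_deriv ::
  "('m, 'k::finite) chart set \<Rightarrow> ('m \<Rightarrow> real ^ 'k) \<Rightarrow> ('m \<Rightarrow> real) \<Rightarrow> 'm \<Rightarrow> real" where
  "dir_deriv A X h p =
     frechet_derivative (h \<circ> chart_inv (chart_at A p)) (at (snd (chart_at A p) p)) (X p)"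

text \<open>
  The Lie bracket at \<open>p\<close> by the coordinate formula
  $[X,Y]^i = X^j \partial_j Y^i - Y^j \partial_j X^i$ in the preferred chart at \<open>p\<close>.
\<close>

definition lie_bracket ::
  "('m, 'k::finite) chart set \<Rightarrow> ('m \<Rightarrow> real ^ 'k) \<Rightarrow> ('m \<Rightarrow> real ^ 'k) \<Rightarrow> 'm \<Rightarrow> real ^ 'k" where
  "lie_bracket A X Y p =
     (let c = chart_at A p; x = snd c p in
        frechet_derivative (vf_rep A c Y) (at x) (X p) -
        frechet_derivative (vf_rep A c X) (at x) (Y p))"


section \<open>Tensor fields\<close>

definition one_form :: "('m, 'k::finite) chart set \<Rightarrow> ('m \<Rightarrow> real ^ 'k \<Rightarrow> real) \<Rightarrow> bool" where
  "one_form A \<omega> \<longleftrightarrow> (\<forall>p. linear (\<omega> p)) \<and>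
     (\<forall>X\<in>vector_fields A. smooth_fun A (\<lambda>p. \<omega> p (X p)))"

definition tensor_11 :: "('m, 'k::finite) chart set \<Rightarrow> ('m \<Rightarrow> real ^ 'k \<Rightarrow> real ^ 'k) \<Rightarrow> bool" where
  "tensor_11 A F \<longleftrightarrow> (\<forall>p. linear (F p)) \<and>
     (\<forall>X\<in>vector_fields A. (\<lambda>p. F p (X p)) \<in> vector_fields A)"

definition riemannian_metric ::
  "('m, 'k::finite) chart set \<Rightarrow> ('m \<Rightarrow> real ^ 'k \<Rightarrow> real ^ 'k \<Rightarrow> real) \<Rightarrow> bool" where
  "riemannian_metric A g \<longleftrightarrow>
     (\<forall>p. bilinear (g p)) \<and> (\<forall>p v w. g p v w = g p w v) \<and> (\<forall>p v. v \<noteq> 0 \<longrightarrow> g p v v > 0) \<and>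
     (\<forall>X\<in>vector_fields A. \<forall>Y\<in>vector_fields A. smooth_fun A (\<lambda>p. g p (X p) (Y p)))"


section \<open>Levi-Civita connection and curvature\<close>

text \<open>\<open>D X Y\<close> is the covariant derivative of \<open>Y\<close> along \<open>X\<close>.\<close>

definition affine_connection ::
  "('m, 'k::finite) chart set \<Rightarrow> (('m \<Rightarrow> real ^ 'k) \<Rightarrow> ('m \<Rightarrow> real ^ 'k) \<Rightarrow> 'm \<Rightarrow> real ^ 'k) \<Rightarrow> bool" where
  "affine_connection A D \<longleftrightarrow>
     (\<forall>X\<in>vector_fields A. \<forall>Y\<in>vector_fields A. D X Y \<in> vector_fields A) \<and>
     (\<forall>X\<in>vector_fields A. \<forall>Y\<in>vector_fields A. \<forall>Z\<in>vector_fields A.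
        D (\<lambda>p. X p + Y p) Z = (\<lambda>p. D X Z p + D Y Z p) \<and>
        D Z (\<lambda>p. X p + Y p) = (\<lambda>p. D Z X p + D Z Y p)) \<and>
     (\<forall>X\<in>vector_fields A. \<forall>Y\<in>vector_fields A. \<forall>h. smooth_fun A h \<longrightarrow>
        D (\<lambda>p. h p *\<^sub>R X p) Y = (\<lambda>p. h p *\<^sub>R D X Y p) \<and>
        D X (\<lambda>p. h p *\<^sub>R Y p) = (\<lambda>p. dir_deriv A X h p *\<^sub>R Y p + h p *\<^sub>R D X Y p))"

definition levi_civita ::
  "('m, 'k::finite) chart set \<Rightarrow> ('m \<Rightarrow> real ^ 'k \<Rightarrow> real ^ 'k \<Rightarrow> real) \<Rightarrow>
   (('m \<Rightarrow> real ^ 'k) \<Rightarrow> ('m \<Rightarrow> real ^ 'k) \<Rightarrow> 'm \<Rightarrow> real ^ 'k) \<Rightarrow> bool" where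
  "levi_civita A g D \<longleftrightarrow> affine_connection A D \<and>
     (\<forall>X\<in>vector_fields A. \<forall>Y\<in>vector_fields A. \<forall>p. D X Y p - D Y X p = lie_bracket A X Y p) \<and>
     (\<forall>X\<in>vector_fields A. \<forall>Y\<in>vector_fields A. \<forall>Z\<in>vector_fields A. \<forall>p.
        dir_deriv A X (\<lambda>q. g q (Y q) (Z q)) p = g p (D X Y p) (Z p) + g p (Y p) (D X Z p))"

definition curvature ::
  "('m, 'k::finite) chart set \<Rightarrow> (('m \<Rightarrow> real ^ 'k) \<Rightarrow> ('m \<Rightarrow> real ^ 'k) \<Rightarrow> 'm \<Rightarrow> real ^ 'k) \<Rightarrow>
   ('m \<Rightarrow> real ^ 'k) \<Rightarrow> ('m \<Rightarrow> real ^ 'k) \<Rightarrow> ('m \<Rightarrow> real ^ 'k) \<Rightarrow> 'm \<Rightarrow> real ^ 'k" where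
  "curvature A D X Y Z = (\<lambda>p. D X (D Y Z) p - D Y (D X Z) p - D (lie_bracket A X Y) Z p)"

text \<open>
  The curvature tensor on tangent vectors \<open>x\<close>, \<open>y\<close>, \<open>z\<close> at \<open>p\<close>: by tensoriality, the common value
  of $R_{X,Y}Z$ at \<open>p\<close> for all vector fields extending \<open>x\<close>, \<open>y\<close>, \<open>z\<close>.
\<close>

definition curvature_at ::
  "('m, 'k::finite) chart set \<Rightarrow> (('m \<Rightarrow> real ^ 'k) \<Rightarrow> ('m \<Rightarrow> real ^ 'k) \<Rightarrow> 'm \<Rightarrow> real ^ 'k) \<Rightarrow>
   'm \<Rightarrow> real ^ 'k \<Rightarrow> real ^ 'k \<Rightarrow> real ^ 'k \<Rightarrow> real ^ 'k" where
  "curvature_at A D p x y z =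
     (THE w. \<forall>X\<in>vector_fields A. \<forall>Y\<in>vector_fields A. \<forall>Z\<in>vector_fields A.
        X p = x \<and> Y p = y \<and> Z p = z \<longrightarrow> curvature A D X Y Z p = w)"

definition endo_trace :: "(real ^ 'k \<Rightarrow> real ^ 'k::finite) \<Rightarrow> real" where
  "endo_trace L = trace (matrix L)"

definition ricci ::
  "('m, 'k::finite) chart set \<Rightarrow> (('m \<Rightarrow> real ^ 'k) \<Rightarrow> ('m \<Rightarrow> real ^ 'k) \<Rightarrow> 'm \<Rightarrow> real ^ 'k) \<Rightarrow>
   'm \<Rightarrow> real ^ 'k \<Rightarrow> real ^ 'k \<Rightarrow> real" where
  "ricci A D p x y = endo_trace (\<lambda>z. curvature_at A D p z x y)"

definition ricci_sharp ::
  "('m, 'k::finite) chart set \<Rightarrow> ('m \<Rightarrow> real ^ 'k \<Rightarrow> real ^ 'k \<Rightarrow> real) \<Rightarrow>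
   (('m \<Rightarrow> real ^ 'k) \<Rightarrow> ('m \<Rightarrow> real ^ 'k) \<Rightarrow> 'm \<Rightarrow> real ^ 'k) \<Rightarrow> 'm \<Rightarrow> real ^ 'k \<Rightarrow> real ^ 'k" where
  "ricci_sharp A g D p x = (THE w. \<forall>y. g p w y = ricci A D p x y)"

definition star_ricci ::
  "('m, 'k::finite) chart set \<Rightarrow> (('m \<Rightarrow> real ^ 'k) \<Rightarrow> ('m \<Rightarrow> real ^ 'k) \<Rightarrow> 'm \<Rightarrow> real ^ 'k) \<Rightarrow>
   ('m \<Rightarrow> real ^ 'k \<Rightarrow> real ^ 'k) \<Rightarrow> 'm \<Rightarrow> real ^ 'k \<Rightarrow> real ^ 'k \<Rightarrow> real" where
  "star_ricci A D f p x y = 1 / 2 * endo_trace (\<lambda>z. curvature_at A D p x (f p y) (f p z))"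

definition orthonormal_frame_at ::
  "('m \<Rightarrow> real ^ 'k \<Rightarrow> real ^ 'k \<Rightarrow> real) \<Rightarrow> 'm \<Rightarrow> ('k::finite \<Rightarrow> real ^ 'k) \<Rightarrow> bool" where
  "orthonormal_frame_at g p e \<longleftrightarrow> (\<forall>i j. g p (e i) (e j) = (if i = j then 1 else 0))"

definition metric_trace ::
  "('m \<Rightarrow> real ^ 'k \<Rightarrow> real ^ 'k::finite \<Rightarrow> real) \<Rightarrow>
   ('m \<Rightarrow> real ^ 'k \<Rightarrow> real ^ 'k \<Rightarrow> real) \<Rightarrow> 'm \<Rightarrow> real" where
  "metric_trace g B p =
     (let e = (SOME e. orthonormal_frame_at g p e) in \<Sum>i\<in>UNIV. B p (e i) (e i))"

definition star_scalar ::
  "('m, 'k::finite) chart set \<Rightarrow> ('m \<Rightarrow> real ^ 'k \<Rightarrow> real ^ 'k \<Rightarrow> real) \<Rightarrow>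
   (('m \<Rightarrow> real ^ 'k) \<Rightarrow> ('m \<Rightarrow> real ^ 'k) \<Rightarrow> 'm \<Rightarrow> real ^ 'k) \<Rightarrow>
   ('m \<Rightarrow> real ^ 'k \<Rightarrow> real ^ 'k) \<Rightarrow> 'm \<Rightarrow> real" where
  "star_scalar A g D f = metric_trace g (star_ricci A D f)"


section \<open>Weak almost contact metric and weak \<open>\<beta>\<close>-Kenmotsu structures\<close>

locale weak_almost_contact_metric = smooth_manifold A
  for A :: "('m::{t2_space, second_countable_topology}, 'k::finite) chart set" +
  fixes n :: nat
    and f Q :: "'m \<Rightarrow> real ^ 'k \<Rightarrow> real ^ 'k"
    and \<xi> :: "'m \<Rightarrow> real ^ 'k"
    and \<eta> :: "'m \<Rightarrow> real ^ 'k \<Rightarrow> real"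
    and g :: "'m \<Rightarrow> real ^ 'k \<Rightarrow> real ^ 'k \<Rightarrow> real"
  assumes n_pos: "n \<ge> 1"
    and dimension: "CARD('k) = 2 * n + 1"
    and f_tensor: "tensor_11 A f"
    and f_rank: "rank (matrix (f p)) = 2 * n"
    and Q_tensor: "tensor_11 A Q"
    and Q_nonsingular: "invertible (matrix (Q p))"
    and xi_field: "\<xi> \<in> vector_fields A"
    and eta_form: "one_form A \<eta>"
    and metric: "riemannian_metric A g"
    and f_squared: "f p (f p v) = - Q p v + \<eta> p v *\<^sub>R \<xi> p"
    and eta_xi: "\<eta> p (\<xi> p) = 1"
    and Q_xi: "Q p (\<xi> p) = \<xi> p"
    and f_metric: "g p (f p v) (f p w) = g p v (Q p w) - \<eta> p v * \<eta> p w"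
    and ker_eta_invariant: "\<eta> p v = 0 \<Longrightarrow> \<eta> p (f p v) = 0"

locale weak_beta_kenmotsu = weak_almost_contact_metric A n f Q \<xi> \<eta> g
  for A :: "('m::{t2_space, second_countable_topology}, 'k::finite) chart set"
    and n f Q \<xi> \<eta> g +
  fixes D :: "('m \<Rightarrow> real ^ 'k) \<Rightarrow> ('m \<Rightarrow> real ^ 'k) \<Rightarrow> 'm \<Rightarrow> real ^ 'k"
    and \<beta> :: real
  assumes connection: "levi_civita A g D"
    and beta_nonzero: "\<beta> \<noteq> 0"
    and kenmotsu: "X \<in> vector_fields A \<Longrightarrow> Y \<in> vector_fields A \<Longrightarrow>
      D X (\<lambda>q. f q (Y q)) p - f p (D X Y p) =
      \<beta> *\<^sub>R (g p (f p (X p)) (Y p) *\<^sub>R \<xi> p - \<eta> p (Y p) *\<^sub>R f p (X p))"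

end

theory Submission
  imports Defs
begin

text \<open>
The idea is to compare \<open>M\<close> with hyperbolic space.  Differentiating the structure equation
$(\nabla_X f)Y = \beta\{g(fX,Y)\xi - \eta(Y)fX\}$ once more and antisymmetrising gives the Ricci identity
for \<open>f\<close>, which says exactly that the shifted tensor
$S_{X,Y}Z = R_{X,Y}Z + \beta^2\{g(Y,Z)X - g(X,Z)Y\}$, the deviation of \<open>R\<close> from constant curvature
$-\beta^2$, commutes with \<open>f\<close> (\<open>ricci_identity_f\<close>).  As the kernel of \<open>f\<close> is spanned by the unit
vector \<open>\<xi>\<close> and \<open>S\<close> is skew, it follows that $S_{X,Y}\xi = 0$.

The rest is linear algebra in one tangent space.  A tensor \<open>S\<close> with the symmetries of a curvature
tensor that commutes with a skew \<open>f\<close> behaves like a Kaehler curvature tensor: the first Bianchi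
identity splits the trace of $Z \mapsto S_{X,fY}fZ$ into two parts, and each of them is
$-\mathrm{Ric}_S(X, f^2Y)$, one by the symmetry under exchange of the two index pairs, the other
because a trace is cyclic (\<open>trace_star\<close>).  With $f^2 = -Q + \eta\otimes\xi$ and $S\xi = 0$, half of the trace is
therefore $\mathrm{Ric}_S(X,QY)$, and undoing the shift produces the terms with $\beta^2$
(\<open>half_trace_star\<close>).  The formula for $r^*$ is the trace of the first formula over an orthonormal
frame, where $\mathrm{trace}\, Q = 2n+1+\mathrm{trace}\, \widetilde Q$ and
$(2n-1)(2n+1)+1 = 4n^2$.

Most of the text lays the foundation, namely that \<open>R\<close> is a tensor with its usual symmetries.
Tensoriality requires global vector fields and functions that look like coordinate fields and
coordinate functions near a given point, hence smooth bump functions.  The symmetries rest on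
$[X,Y]h = X(Yh) - Y(Xh)$, that is, on the symmetry of second derivatives.
\<close>


section \<open>Calculus of smooth maps\<close>

lemma C_k_on_subset: "C_k_on k S f \<Longrightarrow> T \<subseteq> S \<Longrightarrow> C_k_on k T f"
  by (induction k arbitrary: f) (auto intro: continuous_on_subset)

lemma C_k_on_cong:
  assumes "open S" "\<And>x. x \<in> S \<Longrightarrow> f x = g x" "C_k_on k S f"
  shows "C_k_on k S g"
  using assms(2,3)
proof (induction k arbitrary: f g)
  case 0
  then show ?case by (auto cong: continuous_on_cong)
next
  case (Suc k)
  have d: "g differentiable (at x)" "frechet_derivative f (at x) = frechet_derivative g (at x)"
    if "x \<in> S" for x
  proof -
    have f: "f differentiable (at x)" using Suc.prems that by auto
    show "frechet_derivative f (at x) = frechet_derivative g (at x)"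
      using frechet_derivative_transform_within_open[OF f \<open>open S\<close> that] Suc.prems(1) by blast
    show "g differentiable (at x)"
      using f has_derivative_transform_within_open[OF _ \<open>open S\<close> that] Suc.prems(1)
      unfolding differentiable_def by blast
  qed
  have "C_k_on k S (\<lambda>x. frechet_derivative g (at x) v)" for v
    by (rule Suc.IH[of "\<lambda>x. frechet_derivative f (at x) v"]) (use d Suc.prems in auto)
  then show ?case using d by auto
qed

lemma C_k_on_SucD: "C_k_on (Suc k) S f \<Longrightarrow> C_k_on k S f"
proof (induction k arbitrary: f)
  case 0
  then show ?case
    by (auto intro!: continuous_at_imp_continuous_on dest: differentiable_imp_continuous_within)
next
  case (Suc k)
  then show ?case by (metis C_k_on.simps(2))
qed

text \<open>
This allows a function to be glued with the zero function outside the support of a bump function.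
\<close>

lemma C_k_on_local:
  assumes "\<And>x. x \<in> S \<Longrightarrow> \<exists>T. open T \<and> x \<in> T \<and> C_k_on k T f"
  shows "C_k_on k S f"
  using assms
proof (induction k arbitrary: f)
  case 0
  have "isCont f x" if x: "x \<in> S" for x
  proof -
    obtain T where "open T" "x \<in> T" "continuous_on T f" using 0[OF x] by auto
    then show ?thesis using continuous_on_eq_continuous_at by blast
  qed
  then show ?case by (simp add: continuous_at_imp_continuous_on)
next
  case (Suc k)
  have "C_k_on k S (\<lambda>x. frechet_derivative f (at x) v)" for v
    by (rule Suc.IH) (use Suc.prems in fastforce)
  moreover have "f differentiable (at x)" if "x \<in> S" for x
    using Suc.prems[OF that] by auto
  ultimately show ?case by auto
qed

lemma C_k_on_const: "C_k_on k S (\<lambda>x. c)"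
  by (induction k arbitrary: c) auto

lemma C_k_on_add:
  assumes "open S" "C_k_on k S f" "C_k_on k S g"
  shows "C_k_on k S (\<lambda>x. f x + g x)"
  using assms(2,3)
proof (induction k arbitrary: f g)
  case 0
  then show ?case by (auto intro: continuous_on_add)
next
  case (Suc k)
  have d: "((\<lambda>x. f x + g x) has_derivative
      (\<lambda>v. frechet_derivative f (at x) v + frechet_derivative g (at x) v)) (at x)" if "x \<in> S" for x
    using Suc.prems that by (intro has_derivative_add) (auto simp: frechet_derivative_works[symmetric])
  have "C_k_on k S (\<lambda>x. frechet_derivative (\<lambda>x. f x + g x) (at x) v)" for v
    by (rule C_k_on_cong[OF \<open>open S\<close> _ Suc.IH[of "\<lambda>x. frechet_derivative f (at x) v"
            "\<lambda>x. frechet_derivative g (at x) v"]])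
      (use Suc.prems d in \<open>auto simp: frechet_derivative_at[OF d, symmetric]\<close>)
  then show ?case using d by (auto simp: differentiable_def)
qed

lemma C_k_on_bilinear:
  assumes "bounded_bilinear b" "open S" "C_k_on k S f" "C_k_on k S g"
  shows "C_k_on k S (\<lambda>x. b (f x) (g x))"
  using assms(3,4)
proof (induction k arbitrary: f g)
  case 0
  then show ?case by (auto intro: bounded_bilinear.continuous_on[OF assms(1)])
next
  case (Suc k)
  have d: "((\<lambda>x. b (f x) (g x)) has_derivative
      (\<lambda>v. b (f x) (frechet_derivative g (at x) v) + b (frechet_derivative f (at x) v) (g x))) (at x)"
    if "x \<in> S" for x
    using Suc.prems that
    by (intro bounded_bilinear.FDERIV[OF assms(1)]) (auto simp: frechet_derivative_works[symmetric])
  have "C_k_on k S (\<lambda>x. frechet_derivative (\<lambda>x. b (f x) (g x)) (at x) v)" for v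
    by (rule C_k_on_cong[OF \<open>open S\<close> _ C_k_on_add[OF \<open>open S\<close> Suc.IH[of f "\<lambda>x. frechet_derivative g (at x) v"]
          Suc.IH[of "\<lambda>x. frechet_derivative f (at x) v" g]]])
      (use Suc.prems d in \<open>auto simp: frechet_derivative_at[OF d, symmetric] simp del: C_k_on.simps intro: C_k_on_SucD\<close>, 
       auto)
  then show ?case using d by (auto simp: differentiable_def)
qed

lemma C_k_on_sum:
  assumes "open S" "\<And>i. i \<in> I \<Longrightarrow> C_k_on k S (f i)"
  shows "C_k_on k S (\<lambda>x. \<Sum>i\<in>I. f i x)"
  using assms(2)
  by (induction I rule: infinite_finite_induct) (auto intro: C_k_on_const C_k_on_add[OF assms(1)])

lemma C_k_on_linear:
  assumes "bounded_linear L"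
  shows "C_k_on k S L"
proof (cases k)
  case (Suc j)
  have "frechet_derivative L (at x) = L" for x
    using bounded_linear_imp_has_derivative[OF assms] frechet_derivative_at by metis
  then show ?thesis
    using Suc C_k_on_const assms by (auto simp: bounded_linear_imp_differentiable)
qed (use assms in \<open>auto simp: linear_continuous_on\<close>)

text \<open>
The chain rule differentiates \<open>f\<close> in the varying direction \<open>g' v\<close>.  Expanding this direction in a
basis leaves derivatives of \<open>f\<close> in fixed directions, to which the recursion in \<open>C_k_on\<close> applies.
\<close>

lemma linear_basis_expansion:
  fixes L :: "'a::euclidean_space \<Rightarrow> 'b::real_vector"
  assumes "linear L"
  shows "L v = (\<Sum>b\<in>Basis. (v \<bullet> b) *\<^sub>R L b)"
proof -
  have "L v = L (\<Sum>b\<in>Basis. (v \<bullet> b) *\<^sub>R b)" by (simp add: euclidean_representation)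
  also have "\<dots> = (\<Sum>b\<in>Basis. (v \<bullet> b) *\<^sub>R L b)"
    using assms by (simp add: linear_sum linear_cmul)
  finally show ?thesis .
qed

lemma C_k_on_compose:
  fixes f :: "'b::euclidean_space \<Rightarrow> 'c::real_normed_vector" and g :: "'a::euclidean_space \<Rightarrow> 'b"
  assumes "open S" "open T" "g ` S \<subseteq> T" "C_k_on k T f" "C_k_on k S g"
  shows "C_k_on k S (\<lambda>x. f (g x))"
  using assms(4,5)
proof (induction k arbitrary: f)
  case 0
  then show ?case using assms(3) by (auto intro: continuous_on_compose2)
next
  case (Suc k)
  have gS: "g x \<in> T" if "x \<in> S" for x using assms(3) that by auto
  have d: "((\<lambda>x. f (g x)) has_derivative
      (\<lambda>v. frechet_derivative f (at (g x)) (frechet_derivative g (at x) v))) (at x)"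
    if "x \<in> S" for x
    using Suc.prems that gS[OF that]
    by (intro has_derivative_compose[of g _ x UNIV f]) (auto simp: frechet_derivative_works[symmetric])
  have e: "frechet_derivative (\<lambda>x. f (g x)) (at x) v =
     (\<Sum>b\<in>Basis. (frechet_derivative g (at x) v \<bullet> b) *\<^sub>R frechet_derivative f (at (g x)) b)"
    if "x \<in> S" for x v
    unfolding frechet_derivative_at[OF d[OF that], symmetric]
    by (intro linear_basis_expansion linear_frechet_derivative) (use Suc.prems gS[OF that] in auto)
  have i: "C_k_on k S (\<lambda>x. (frechet_derivative g (at x) v \<bullet> b) *\<^sub>R frechet_derivative f (at (g x)) b)"
    for v b
  proof (intro C_k_on_bilinear[OF bounded_bilinear_scaleR assms(1)] C_k_on_bilinear[OF bounded_bilinear_inner assms(1)] C_k_on_const)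
    show "C_k_on k S (\<lambda>x. frechet_derivative g (at x) v)" using Suc.prems by auto
    show "C_k_on k S (\<lambda>x. frechet_derivative f (at (g x)) b)"
      using Suc.prems C_k_on_SucD[OF Suc.prems(2)] by (intro Suc.IH) auto
  qed
  have "C_k_on k S (\<lambda>x. frechet_derivative (\<lambda>x. f (g x)) (at x) v)" for v
    by (rule C_k_on_cong[OF assms(1) e[symmetric] C_k_on_sum[OF assms(1) i]])
  then show ?case using d by (auto simp: differentiable_def)
qed

lemma smooth_map_on_subset: "smooth_map_on S f \<Longrightarrow> T \<subseteq> S \<Longrightarrow> smooth_map_on T f"
  by (auto simp: smooth_map_on_def intro: C_k_on_subset)

lemma smooth_map_on_cong:
  "open S \<Longrightarrow> (\<And>x. x \<in> S \<Longrightarrow> f x = g x) \<Longrightarrow> smooth_map_on S f \<Longrightarrow> smooth_map_on S g"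
  unfolding smooth_map_on_def using C_k_on_cong by metis

lemma smooth_map_on_local:
  "(\<And>x. x \<in> S \<Longrightarrow> \<exists>T. open T \<and> x \<in> T \<and> smooth_map_on T f) \<Longrightarrow> smooth_map_on S f"
  unfolding smooth_map_on_def by (metis C_k_on_local)

lemma smooth_map_on_const: "smooth_map_on S (\<lambda>x. c)"
  by (simp add: smooth_map_on_def C_k_on_const)

lemma smooth_map_on_linear: "bounded_linear L \<Longrightarrow> smooth_map_on S L"
  by (simp add: smooth_map_on_def C_k_on_linear)

lemma smooth_map_on_add:
  "open S \<Longrightarrow> smooth_map_on S f \<Longrightarrow> smooth_map_on S g \<Longrightarrow> smooth_map_on S (\<lambda>x. f x + g x)"
  by (simp add: smooth_map_on_def C_k_on_add)

lemma smooth_map_on_bilinear: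
  "bounded_bilinear b \<Longrightarrow> open S \<Longrightarrow> smooth_map_on S f \<Longrightarrow> smooth_map_on S g
    \<Longrightarrow> smooth_map_on S (\<lambda>x. b (f x) (g x))"
  by (simp add: smooth_map_on_def C_k_on_bilinear)

lemmas smooth_map_on_scaleR = smooth_map_on_bilinear[OF bounded_bilinear_scaleR]
lemmas smooth_map_on_mult = smooth_map_on_bilinear[OF bounded_bilinear_mult]

lemma smooth_map_on_sum:
  "open S \<Longrightarrow> (\<And>i. i \<in> I \<Longrightarrow> smooth_map_on S (f i)) \<Longrightarrow> smooth_map_on S (\<lambda>x. \<Sum>i\<in>I. f i x)"
  by (simp add: smooth_map_on_def C_k_on_sum)

lemma smooth_map_on_compose:
  fixes f :: "'b::euclidean_space \<Rightarrow> 'c::real_normed_vector" and g :: "'a::euclidean_space \<Rightarrow> 'b"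
  shows "open S \<Longrightarrow> open T \<Longrightarrow> g ` S \<subseteq> T \<Longrightarrow> smooth_map_on T f \<Longrightarrow> smooth_map_on S g
    \<Longrightarrow> smooth_map_on S (\<lambda>x. f (g x))"
  by (simp add: smooth_map_on_def C_k_on_compose)

lemma smooth_map_on_differentiable:
  "smooth_map_on S f \<Longrightarrow> x \<in> S \<Longrightarrow> f differentiable (at x)"
  unfolding smooth_map_on_def by (metis C_k_on.simps(2))

lemma smooth_map_on_frechet_derivative:
  "smooth_map_on S f \<Longrightarrow> smooth_map_on S (\<lambda>x. frechet_derivative f (at x) v)"
  unfolding smooth_map_on_def by (metis C_k_on.simps(2))

lemma smooth_map_on_frechet_derivative_along:
  assumes "open S" "smooth_map_on S f" "smooth_map_on S v"
  shows "smooth_map_on S (\<lambda>x. frechet_derivative f (at x) (v x))"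
proof (rule smooth_map_on_cong[OF assms(1)])
  show "smooth_map_on S (\<lambda>x. \<Sum>b\<in>Basis. (v x \<bullet> b) *\<^sub>R frechet_derivative f (at x) b)"
    by (intro smooth_map_on_sum smooth_map_on_scaleR smooth_map_on_bilinear[OF bounded_bilinear_inner]
        smooth_map_on_frechet_derivative smooth_map_on_const assms)
  show "(\<Sum>b\<in>Basis. (v x \<bullet> b) *\<^sub>R frechet_derivative f (at x) b) = frechet_derivative f (at x) (v x)"
    if "x \<in> S" for x
    by (intro linear_basis_expansion[symmetric] linear_frechet_derivative
        smooth_map_on_differentiable[OF assms(2) that])
qed


section \<open>Symmetry of second derivatives\<close>

text \<open>
Two applications of the mean value theorem: first to $h(x+su+rv)-h(x+su)$ as a function of
$s \in [0,r]$, then in the direction \<open>v\<close> to the derivative that appears.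
The left-hand side is symmetric in \<open>u\<close> and \<open>v\<close>, which is the source of the symmetry of second
derivatives.
\<close>

lemma second_difference_mean_value:
  fixes h :: "'a::euclidean_space \<Rightarrow> real"
  assumes smooth: "smooth_map_on S h" and "r > 0"
    and S: "\<And>s t. 0 \<le> s \<Longrightarrow> s \<le> r \<Longrightarrow> 0 \<le> t \<Longrightarrow> t \<le> r \<Longrightarrow> x + s *\<^sub>R u + t *\<^sub>R v \<in> S"
  obtains \<sigma> \<tau> where "0 < \<sigma>" "\<sigma> < r" "0 < \<tau>" "\<tau> < r"
    "h (x + r *\<^sub>R u + r *\<^sub>R v) - h (x + r *\<^sub>R u) - h (x + r *\<^sub>R v) + h x =
     r * r * frechet_derivative (\<lambda>y. frechet_derivative h (at y) u) (at (x + \<sigma> *\<^sub>R u + \<tau> *\<^sub>R v)) v"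
proof -
  let ?Du = "\<lambda>y. frechet_derivative h (at y) u"
  have line: "((\<lambda>s. k (a + s *\<^sub>R w)) has_real_derivative
      frechet_derivative k (at (a + s *\<^sub>R w)) w) (at s)"
    if "k differentiable (at (a + s *\<^sub>R w))" for k :: "'a \<Rightarrow> real" and a w s
  proof -
    have "((\<lambda>s. a + s *\<^sub>R w) has_derivative (\<lambda>s. s *\<^sub>R w)) (at s)"
      by (auto intro!: derivative_eq_intros)
    from has_derivative_compose[OF this that[unfolded frechet_derivative_works]]
    show ?thesis
      unfolding has_field_derivative_def
      by (rule has_derivative_eq_rhs)
        (simp add: fun_eq_iff linear_cmul[OF linear_frechet_derivative[OF that]])
  qed
  have dh: "h differentiable (at y)" if "y \<in> S" for y
    using smooth_map_on_differentiable[OF smooth that] .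
  have dDu: "?Du differentiable (at y)" if "y \<in> S" for y
    using smooth_map_on_differentiable[OF smooth_map_on_frechet_derivative[OF smooth] that] .
  have "\<exists>\<sigma>>0. \<sigma> < r \<and>
      (h ((x + r *\<^sub>R v) + r *\<^sub>R u) - h (x + r *\<^sub>R u)) - (h ((x + r *\<^sub>R v) + 0 *\<^sub>R u) - h (x + 0 *\<^sub>R u)) =
      (r - 0) * (?Du ((x + r *\<^sub>R v) + \<sigma> *\<^sub>R u) - ?Du (x + \<sigma> *\<^sub>R u))"
  proof (rule MVT2[OF \<open>r > 0\<close>])
    fix s assume s: "0 \<le> s" "s \<le> r"
    show "((\<lambda>s. h ((x + r *\<^sub>R v) + s *\<^sub>R u) - h (x + s *\<^sub>R u)) has_real_derivative
        (?Du ((x + r *\<^sub>R v) + s *\<^sub>R u) - ?Du (x + s *\<^sub>R u))) (at s)"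
      using S[of s r] S[of s 0] s \<open>r > 0\<close>
      by (intro DERIV_diff line dh) (auto simp: add_ac)
  qed
  then obtain \<sigma> where \<sigma>: "0 < \<sigma>" "\<sigma> < r" and 1:
    "h (x + r *\<^sub>R u + r *\<^sub>R v) - h (x + r *\<^sub>R u) - h (x + r *\<^sub>R v) + h x =
      r * (?Du ((x + r *\<^sub>R v) + \<sigma> *\<^sub>R u) - ?Du (x + \<sigma> *\<^sub>R u))"
    by (auto simp: algebra_simps)
  have "\<exists>\<tau>>0. \<tau> < r \<and>
      ?Du ((x + \<sigma> *\<^sub>R u) + r *\<^sub>R v) - ?Du ((x + \<sigma> *\<^sub>R u) + 0 *\<^sub>R v) =
      (r - 0) * frechet_derivative ?Du (at ((x + \<sigma> *\<^sub>R u) + \<tau> *\<^sub>R v)) v"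
    by (rule MVT2[OF \<open>r > 0\<close>], rule line, rule dDu, rule S) (use \<sigma> in auto)
  then obtain \<tau> where "0 < \<tau>" "\<tau> < r"
    "?Du ((x + \<sigma> *\<^sub>R u) + r *\<^sub>R v) - ?Du (x + \<sigma> *\<^sub>R u) =
      r * frechet_derivative ?Du (at (x + \<sigma> *\<^sub>R u + \<tau> *\<^sub>R v)) v"
    by auto
  with 1 \<sigma> that[of \<sigma> \<tau>] show thesis by (simp add: algebra_simps)
qed

text \<open>
For small \<open>r\<close> the symmetric second difference is $r^2$ times either mixed derivative at some point
close to \<open>x\<close>, so continuity makes the two mixed derivatives at \<open>x\<close> agree.
\<close>

lemma symmetric_second_frechet_derivative:
  fixes h :: "'a::euclidean_space \<Rightarrow> real"
  assumes "open S" "x \<in> S" and smooth: "smooth_map_on S h"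
  shows "frechet_derivative (\<lambda>y. frechet_derivative h (at y) u) (at x) v =
         frechet_derivative (\<lambda>y. frechet_derivative h (at y) v) (at x) u"
proof -
  let ?D = "\<lambda>u v y. frechet_derivative (\<lambda>y. frechet_derivative h (at y) u) (at y) v"
  have cont: "isCont (?D u v) x" for u v
    using smooth_map_on_differentiable[OF smooth_map_on_frechet_derivative[OF
          smooth_map_on_frechet_derivative[OF smooth]] \<open>x \<in> S\<close>]
    by (rule differentiable_imp_continuous_within)
  have "\<bar>?D u v x - ?D v u x\<bar> \<le> e" if "e > 0" for e
  proof -
    obtain d1 where d1: "d1 > 0" "\<And>y. dist y x < d1 \<Longrightarrow> dist (?D u v y) (?D u v x) < e / 2"
      using cont[of u v] \<open>e > 0\<close> unfolding continuous_at_eps_delta by (metis half_gt_zero)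
    obtain d2 where d2: "d2 > 0" "\<And>y. dist y x < d2 \<Longrightarrow> dist (?D v u y) (?D v u x) < e / 2"
      using cont[of v u] \<open>e > 0\<close> unfolding continuous_at_eps_delta by (metis half_gt_zero)
    obtain d3 where d3: "d3 > 0" "\<And>y. dist y x < d3 \<Longrightarrow> y \<in> S"
      using assms(1,2) unfolding open_dist by blast
    define d where "d = min d1 (min d2 d3)"
    define r where "r = d / (norm u + norm v + 1)"
    have N: "norm u + norm v + 1 > 0" by (simp add: add_nonneg_pos)
    have "d > 0" using d1(1) d2(1) d3(1) by (simp add: d_def)
    then have "r > 0" using N by (simp add: r_def)
    have near: "dist (x + s *\<^sub>R u + t *\<^sub>R v) x < d" if "0 \<le> s" "s \<le> r" "0 \<le> t" "t \<le> r" for s t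
    proof -
      have "dist (x + s *\<^sub>R u + t *\<^sub>R v) x = norm (s *\<^sub>R u + t *\<^sub>R v)" by (simp add: dist_norm)
      also have "\<dots> \<le> s * norm u + t * norm v" using norm_triangle_ineq[of "s *\<^sub>R u" "t *\<^sub>R v"] that by simp
      also have "\<dots> \<le> r * norm u + r * norm v" using that by (intro add_mono mult_right_mono) auto
      also have "\<dots> < r * (norm u + norm v + 1)" using \<open>r > 0\<close> by (simp add: algebra_simps)
      also have "\<dots> = d" using N by (simp add: r_def)
      finally show ?thesis .
    qed
    have near': "dist (x + s *\<^sub>R v + t *\<^sub>R u) x < d" if "0 \<le> s" "s \<le> r" "0 \<le> t" "t \<le> r" for s t
      using near[of t s] that by (simp add: add_ac)
    obtain \<sigma> \<tau> where st: "0 < \<sigma>" "\<sigma> < r" "0 < \<tau>" "\<tau> < r" and 1: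
      "h (x + r *\<^sub>R u + r *\<^sub>R v) - h (x + r *\<^sub>R u) - h (x + r *\<^sub>R v) + h x =
       r * r * ?D u v (x + \<sigma> *\<^sub>R u + \<tau> *\<^sub>R v)"
      using second_difference_mean_value[OF smooth \<open>r > 0\<close>, of x u v] near d3 unfolding d_def
      by (metis min_less_iff_conj)
    obtain \<sigma>' \<tau>' where st': "0 < \<sigma>'" "\<sigma>' < r" "0 < \<tau>'" "\<tau>' < r" and 2:
      "h (x + r *\<^sub>R v + r *\<^sub>R u) - h (x + r *\<^sub>R v) - h (x + r *\<^sub>R u) + h x =
       r * r * ?D v u (x + \<sigma>' *\<^sub>R v + \<tau>' *\<^sub>R u)"
      using second_difference_mean_value[OF smooth \<open>r > 0\<close>, of x v u] near' d3 unfolding d_def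
      by (metis min_less_iff_conj)
    have "r * r * ?D u v (x + \<sigma> *\<^sub>R u + \<tau> *\<^sub>R v) = r * r * ?D v u (x + \<sigma>' *\<^sub>R v + \<tau>' *\<^sub>R u)"
    proof -
      have "x + r *\<^sub>R v + r *\<^sub>R u = x + r *\<^sub>R u + r *\<^sub>R v" by (simp add: add_ac)
      with 1 2 show ?thesis by (simp only:)
    qed
    then have "?D u v (x + \<sigma> *\<^sub>R u + \<tau> *\<^sub>R v) = ?D v u (x + \<sigma>' *\<^sub>R v + \<tau>' *\<^sub>R u)"
      using \<open>r > 0\<close> by simp
    moreover have "dist (?D u v (x + \<sigma> *\<^sub>R u + \<tau> *\<^sub>R v)) (?D u v x) < e / 2"
      by (rule d1) (use near[of \<sigma> \<tau>] st in \<open>auto simp: d_def\<close>)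
    moreover have "dist (?D v u (x + \<sigma>' *\<^sub>R v + \<tau>' *\<^sub>R u)) (?D v u x) < e / 2"
      by (rule d2) (use near'[of \<sigma>' \<tau>'] st' in \<open>auto simp: d_def\<close>)
    ultimately show ?thesis unfolding dist_real_def by linarith
  qed
  then show ?thesis by (metis abs_le_zero_iff dense_ge eq_iff_diff_eq_0)
qed


section \<open>Smooth bump functions\<close>

text \<open>
For \<open>P = 1\<close> this is the standard function that is flat at \<open>0\<close>.  Polynomials in \<open>1 / t\<close> are included as
factors because this makes the family closed under differentiation.
\<close>

definition flat_exp :: "real poly \<Rightarrow> real \<Rightarrow> real" where
  "flat_exp P t = (if t > 0 then poly P (1 / t) * exp (- (1 / t)) else 0)"

lemma tendsto_flat_exp_0: "(flat_exp P \<longlongrightarrow> 0) (at 0)"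
proof -
  have "((\<lambda>x. \<Sum>i\<le>degree P. coeff P i * (x ^ i / exp x)) \<longlongrightarrow> (\<Sum>i\<le>degree P. coeff P i * 0)) at_top"
    by (intro tendsto_intros tendsto_power_div_exp_0)
  then have "((\<lambda>x. poly P x * exp (- x)) \<longlongrightarrow> 0) at_top"
    by (simp add: poly_altdef sum_distrib_right exp_minus divide_inverse mult.assoc)
  then have "((\<lambda>t. poly P (inverse t) * exp (- inverse t)) \<longlongrightarrow> 0) (at_right 0)"
    by (rule filterlim_compose[OF _ filterlim_inverse_at_top_right])
  then have "(flat_exp P \<longlongrightarrow> 0) (at_right 0)"
    by (rule Lim_transform_eventually) (auto simp: eventually_at_right_field flat_exp_def divide_inverse intro: exI[of _ 1])
  moreover have "(flat_exp P \<longlongrightarrow> 0) (at_left 0)"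
    by (rule Lim_transform_eventually[OF tendsto_const]) (auto simp: eventually_at_left_field flat_exp_def intro: exI[of _ "-1"])
  ultimately show ?thesis by (simp add: filterlim_split_at)
qed

text \<open>
With \<open>x = 1 / t\<close>, the derivative of $P(x)e^{-x}$ with respect to \<open>t\<close> is $x^2(P-P')(x)e^{-x}$.  The
difference quotient at \<open>0\<close> is again a function of this family, for the polynomial \<open>xP\<close>.
\<close>

lemma flat_exp_has_derivative:
  "(flat_exp P has_real_derivative flat_exp ([:0, 0, 1:] * (P - pderiv P)) t) (at t)"
proof -
  consider "t > 0" | "t < 0" | "t = 0" by linarith
  then show ?thesis
  proof cases
    case 1
    have "((\<lambda>t. poly P (1 / t) * exp (- (1 / t))) has_real_derivative
        flat_exp ([:0, 0, 1:] * (P - pderiv P)) t) (at t)"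
      using 1 by (auto intro!: derivative_eq_intros simp: flat_exp_def field_simps power2_eq_square)
    then show ?thesis
      by (rule has_field_derivative_transform_within_open[of _ _ _ "{0<..}"]) (use 1 in \<open>auto simp: flat_exp_def\<close>)
  next
    case 2
    have "((\<lambda>t. 0) has_real_derivative flat_exp ([:0, 0, 1:] * (P - pderiv P)) t) (at t)"
      using 2 by (simp add: flat_exp_def)
    then show ?thesis
      by (rule has_field_derivative_transform_within_open[of _ _ _ "{..<0}"]) (use 2 in \<open>auto simp: flat_exp_def\<close>)
  next
    case 3
    have "((\<lambda>t. (flat_exp P t - flat_exp P 0) / (t - 0)) \<longlongrightarrow> 0) (at 0)"
      by (rule Lim_transform_eventually[OF tendsto_flat_exp_0[of "[:0, 1:] * P"]])
        (auto simp: flat_exp_def eventually_at intro!: exI[of _ 1])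
    then show ?thesis using 3 by (simp add: has_field_derivative_iff flat_exp_def)
  qed
qed

lemma smooth_flat_exp: "smooth_map_on UNIV (flat_exp P)"
proof -
  have der: "frechet_derivative (flat_exp P) (at t) v = v * flat_exp ([:0, 0, 1:] * (P - pderiv P)) t" for P t v
    using frechet_derivative_at[OF flat_exp_has_derivative[unfolded has_field_derivative_def], of P t]
    by (metis mult.commute)
  have diff: "flat_exp P differentiable (at t)" for P t
    using flat_exp_has_derivative real_differentiable_def by blast
  have "C_k_on k UNIV (flat_exp P)" for k
  proof (induction k arbitrary: P)
    case 0
    then show ?case using diff by (simp add: continuous_at_imp_continuous_on differentiable_imp_continuous_within)
  next
    case (Suc k)
    then show ?case
      using diff C_k_on_bilinear[OF bounded_bilinear_mult open_UNIV C_k_on_const Suc.IH]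
      by (simp add: der del: mult_pCons_left)
  qed
  then show ?thesis by (simp add: smooth_map_on_def)
qed

text \<open>
A flat function of $r^2 - |y-x|^2$, normalised to \<open>1\<close> at the centre.
\<close>

lemma exists_smooth_bump:
  fixes x :: "'a::euclidean_space"
  assumes "open U" "x \<in> U"
  obtains \<psi> :: "'a \<Rightarrow> real" and K
  where "smooth_map_on UNIV \<psi>" "compact K" "K \<subseteq> U" "\<psi> x = 1" "\<And>y. y \<notin> K \<Longrightarrow> \<psi> y = 0"
proof -
  obtain r where r: "r > 0" "cball x r \<subseteq> U" using assms open_contains_cball by blast
  define \<psi> where "\<psi> y = flat_exp 1 (r\<^sup>2 - (y - x) \<bullet> (y - x)) / flat_exp 1 (r\<^sup>2)" for y
  have "smooth_map_on UNIV (\<lambda>y. (y - x) \<bullet> (y - x))"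
    using smooth_map_on_add[OF open_UNIV smooth_map_on_linear[OF bounded_linear_ident] smooth_map_on_const[of _ "- x"]]
    by (intro smooth_map_on_bilinear[OF bounded_bilinear_inner]) auto
  then have "smooth_map_on UNIV (\<lambda>y. r\<^sup>2 + (-1) * ((y - x) \<bullet> (y - x)))"
    by (intro smooth_map_on_add smooth_map_on_mult smooth_map_on_const) auto
  then have "smooth_map_on UNIV (\<lambda>y. flat_exp 1 (r\<^sup>2 + (-1) * ((y - x) \<bullet> (y - x))) * (1 / flat_exp 1 (r\<^sup>2)))"
    by (intro smooth_map_on_mult smooth_map_on_const smooth_map_on_compose[OF _ _ _ smooth_flat_exp]) auto
  then have 1: "smooth_map_on UNIV \<psi>" by (simp add: \<psi>_def[abs_def])
  have 2: "\<psi> y = 0" if "y \<notin> cball x r" for y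
  proof -
    have "r < norm (y - x)" using that by (simp add: dist_norm norm_minus_commute)
    then have "r\<^sup>2 < (y - x) \<bullet> (y - x)" using r(1) by (simp add: power2_norm_eq_inner[symmetric] power_strict_mono)
    then show ?thesis by (simp add: \<psi>_def flat_exp_def)
  qed
  have 3: "\<psi> x = 1" using r(1) by (simp add: \<psi>_def flat_exp_def)
  show thesis by (rule that[of \<psi> "cball x r"]) (use 1 2 3 r in auto)
qed


section \<open>Vector fields as derivations\<close>

text \<open>
The product rule for $y \mapsto dH_y(V(y))$: either the field or the differential is differentiated.
In the commutator of two fields the second summand cancels by symmetry, and the first gives the
bracket.
\<close>

lemma frechet_derivative_along_field:
  fixes H :: "'a::euclidean_space \<Rightarrow> real" and V :: "'a \<Rightarrow> 'a"
  assumes "open S" "x \<in> S" "smooth_map_on S H" "smooth_map_on S V"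
  shows "frechet_derivative (\<lambda>y. frechet_derivative H (at y) (V y)) (at x) w =
     frechet_derivative H (at x) (frechet_derivative V (at x) w) +
     frechet_derivative (\<lambda>y. frechet_derivative H (at y) (V x)) (at x) w"
proof -
  have lin: "linear (frechet_derivative H (at y))" if "y \<in> S" for y
    by (intro linear_frechet_derivative smooth_map_on_differentiable[OF assms(3) that])
  let ?D = "\<lambda>b. frechet_derivative (\<lambda>y. frechet_derivative H (at y) b) (at x)"
  have dH: "((\<lambda>y. frechet_derivative H (at y) b) has_derivative ?D b) (at x)" for b
    unfolding frechet_derivative_works[symmetric]
    by (rule smooth_map_on_differentiable[OF smooth_map_on_frechet_derivative[OF assms(3)] assms(2)])
  have dV: "(V has_derivative frechet_derivative V (at x)) (at x)"
    unfolding frechet_derivative_works[symmetric]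
    by (rule smooth_map_on_differentiable[OF assms(4,2)])
  have "((\<lambda>y. \<Sum>b\<in>Basis. (V y \<bullet> b) * frechet_derivative H (at y) b) has_derivative
     (\<lambda>w. \<Sum>b\<in>Basis. (V x \<bullet> b) * ?D b w + (frechet_derivative V (at x) w \<bullet> b) * frechet_derivative H (at x) b)) (at x)"
    by (intro has_derivative_sum has_derivative_mult dH has_derivative_inner_left dV)
  then have "((\<lambda>y. frechet_derivative H (at y) (V y)) has_derivative
     (\<lambda>w. \<Sum>b\<in>Basis. (V x \<bullet> b) * ?D b w + (frechet_derivative V (at x) w \<bullet> b) * frechet_derivative H (at x) b)) (at x)"
    by (rule has_derivative_transform_within_open[OF _ assms(1,2)])
      (use linear_basis_expansion[OF lin] in simp)
  then have 1: "frechet_derivative (\<lambda>y. frechet_derivative H (at y) (V y)) (at x) w =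
     (\<Sum>b\<in>Basis. (V x \<bullet> b) * ?D b w) +
     (\<Sum>b\<in>Basis. (frechet_derivative V (at x) w \<bullet> b) * frechet_derivative H (at x) b)"
    by (subst frechet_derivative_at[symmetric], assumption) (simp add: sum.distrib)
  have "((\<lambda>y. \<Sum>b\<in>Basis. (V x \<bullet> b) * frechet_derivative H (at y) b) has_derivative
     (\<lambda>w. \<Sum>b\<in>Basis. (V x \<bullet> b) * ?D b w)) (at x)"
    by (intro has_derivative_sum has_derivative_mult_right dH)
  then have "((\<lambda>y. frechet_derivative H (at y) (V x)) has_derivative
     (\<lambda>w. \<Sum>b\<in>Basis. (V x \<bullet> b) * ?D b w)) (at x)"
    by (rule has_derivative_transform_within_open[OF _ assms(1,2)])
      (use linear_basis_expansion[OF lin] in simp)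
  then have 2: "frechet_derivative (\<lambda>y. frechet_derivative H (at y) (V x)) (at x) w =
     (\<Sum>b\<in>Basis. (V x \<bullet> b) * ?D b w)"
    by (subst frechet_derivative_at[symmetric], assumption) simp
  have 3: "frechet_derivative H (at x) (frechet_derivative V (at x) w) =
     (\<Sum>b\<in>Basis. (frechet_derivative V (at x) w \<bullet> b) * frechet_derivative H (at x) b)"
    using linear_basis_expansion[OF lin[OF assms(2)], of "frechet_derivative V (at x) w"] by simp
  show ?thesis unfolding 1 2 3 by simp
qed

context smooth_manifold
begin

lemma chart_at_in [simp]: "chart_at A p \<in> A" and in_chart_at [simp]: "p \<in> fst (chart_at A p)"
proof -
  have "\<exists>c. c \<in> A \<and> p \<in> fst c" using cover by blast
  then have "chart_at A p \<in> A \<and> p \<in> fst (chart_at A p)" unfolding chart_at_def by (rule someI_ex)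
  then show "chart_at A p \<in> A" "p \<in> fst (chart_at A p)" by auto
qed

lemma open_chart_image: "c \<in> A \<Longrightarrow> open (snd c ` fst c)"
  using charts unfolding is_chart_def by auto

lemma open_chart_domain: "c \<in> A \<Longrightarrow> open (fst c)"
  using charts unfolding is_chart_def by auto

lemma chart_inv_chart [simp]: "c \<in> A \<Longrightarrow> q \<in> fst c \<Longrightarrow> chart_inv c (snd c q) = q"
  using charts unfolding is_chart_def homeomorphism_def by auto

lemma continuous_on_chart_inv: "c \<in> A \<Longrightarrow> continuous_on (snd c ` fst c) (chart_inv c)"
  using charts unfolding is_chart_def homeomorphism_def by auto

lemma open_chart_image_Int:
  assumes "c \<in> A" "open V"
  shows "open (snd c ` (fst c \<inter> V))"
proof -
  have "snd c ` (fst c \<inter> V) = snd c ` fst c \<inter> chart_inv c -` V"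
    using assms(1) by auto
  then show ?thesis
    using continuous_open_preimage[OF continuous_on_chart_inv open_chart_image assms(2)] assms(1) by metis
qed

lemma transition_differentiable:
  assumes "c \<in> A" "d \<in> A" "q \<in> fst c" "q \<in> fst d"
  shows "(snd d \<circ> chart_inv c) differentiable (at (snd c q))"
  using smooth_map_on_differentiable[OF compatible[OF assms(1,2)]] assms by blast

text \<open>
The chain rule for a change of charts.  It yields that \<open>chart_diff\<close> is a cocycle with inverses, and that
the derivative of a function along a vector field can be computed in any chart.
\<close>

lemma derivative_chart_change:
  fixes h :: "'m \<Rightarrow> 'c::real_normed_vector"
  assumes c: "c \<in> A" "q \<in> fst c" and d: "d \<in> A" "q \<in> fst d"
    and h: "(h \<circ> chart_inv d) differentiable (at (snd d q))"
  shows "frechet_derivative (h \<circ> chart_inv c) (at (snd c q)) v =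
     frechet_derivative (h \<circ> chart_inv d) (at (snd d q)) (frechet_derivative (snd d \<circ> chart_inv c) (at (snd c q)) v)"
proof -
  have "((h \<circ> chart_inv d) has_derivative frechet_derivative (h \<circ> chart_inv d) (at (snd d q)))
     (at ((snd d \<circ> chart_inv c) (snd c q)))"
    using h c by (simp add: frechet_derivative_works)
  from diff_chain_at[OF transition_differentiable[OF c(1) d(1) c(2) d(2), unfolded frechet_derivative_works] this]
  have "((h \<circ> chart_inv d) \<circ> (snd d \<circ> chart_inv c) has_derivative
     frechet_derivative (h \<circ> chart_inv d) (at (snd d q)) \<circ> frechet_derivative (snd d \<circ> chart_inv c) (at (snd c q)))
     (at (snd c q))" .
  then have "(h \<circ> chart_inv c has_derivative
     frechet_derivative (h \<circ> chart_inv d) (at (snd d q)) \<circ> frechet_derivative (snd d \<circ> chart_inv c) (at (snd c q)))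
     (at (snd c q))"
    by (rule has_derivative_transform_within_open[OF _ open_chart_image_Int[OF c(1) open_chart_domain[OF d(1)]]])
      (use c d in auto)
  then show ?thesis by (metis comp_apply frechet_derivative_at)
qed

lemma derivative_chart_self:
  assumes "c \<in> A" "q \<in> fst c"
  shows "frechet_derivative (snd c \<circ> chart_inv c) (at (snd c q)) v = v"
proof -
  have "(snd c \<circ> chart_inv c has_derivative (\<lambda>v. v)) (at (snd c q))"
    by (rule has_derivative_transform_within_open[OF has_derivative_ident open_chart_image[OF assms(1)]])
      (use assms in auto)
  then show ?thesis by (metis frechet_derivative_at)
qed

lemma linear_chart_diff: "c \<in> A \<Longrightarrow> q \<in> fst c \<Longrightarrow> linear (chart_diff A c q)"
  unfolding chart_diff_def by (intro linear_frechet_derivative transition_differentiable) auto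

lemma chart_diff_cocycle:
  assumes "c \<in> A" "q \<in> fst c" "d \<in> A" "q \<in> fst d"
  shows "chart_diff A d q (frechet_derivative (snd (chart_at A q) \<circ> chart_inv c) (at (snd c q)) v) =
     frechet_derivative (snd d \<circ> chart_inv c) (at (snd c q)) v"
  unfolding chart_diff_def
  by (rule derivative_chart_change[symmetric]) (use assms in \<open>auto intro: transition_differentiable\<close>)

lemma inverse_chart_diff:
  assumes "c \<in> A" "q \<in> fst c"
  shows "frechet_derivative (snd (chart_at A q) \<circ> chart_inv c) (at (snd c q)) (chart_diff A c q v) = v"
  unfolding chart_diff_def
  by (subst derivative_chart_change[symmetric]) (use assms in \<open>auto intro: transition_differentiable simp: derivative_chart_self\<close>)

lemma vf_rep_preferred [simp]: "vf_rep A (chart_at A p) X (snd (chart_at A p) p) = X p"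
  by (simp add: vf_rep_def chart_diff_def derivative_chart_self)

lemma smooth_funD: "smooth_fun A h \<Longrightarrow> c \<in> A \<Longrightarrow> smooth_map_on (snd c ` fst c) (h \<circ> chart_inv c)"
  unfolding smooth_fun_def by auto

lemma vector_fieldsD: "X \<in> vector_fields A \<Longrightarrow> c \<in> A \<Longrightarrow> smooth_map_on (snd c ` fst c) (vf_rep A c X)"
  unfolding vector_fields_def by auto

text \<open>
The definition of \<open>dir_deriv\<close> uses a chart that may change from point to point.  Second derivatives need
one chart on a whole neighbourhood, which is what this provides.
\<close>

lemma dir_deriv_in_chart:
  assumes "c \<in> A" "q \<in> fst c" "smooth_fun A h"
  shows "dir_deriv A X h q = frechet_derivative (h \<circ> chart_inv c) (at (snd c q)) (vf_rep A c X (snd c q))"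
proof -
  have "(h \<circ> chart_inv c) differentiable (at (snd c q))"
    using smooth_map_on_differentiable[OF smooth_funD] assms by blast
  then show ?thesis
    unfolding dir_deriv_def vf_rep_def chart_diff_def
    by (subst derivative_chart_change[of "chart_at A q" q c]) (use assms in auto)
qed

lemma smooth_fun_const: "smooth_fun A (\<lambda>q. r)"
  by (simp add: smooth_fun_def comp_def smooth_map_on_const)

lemma smooth_fun_mult: "smooth_fun A h \<Longrightarrow> smooth_fun A k \<Longrightarrow> smooth_fun A (\<lambda>q. h q * k q)"
  using open_chart_image by (auto simp: smooth_fun_def comp_def intro: smooth_map_on_mult)

lemma vector_fields_add:
  assumes "X \<in> vector_fields A" "Y \<in> vector_fields A"
  shows "(\<lambda>q. X q + Y q) \<in> vector_fields A"
  unfolding vector_fields_def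
proof (intro CollectI ballI)
  fix c assume c: "c \<in> A"
  show "smooth_map_on (snd c ` fst c) (vf_rep A c (\<lambda>q. X q + Y q))"
    by (rule smooth_map_on_cong[OF open_chart_image[OF c] _ smooth_map_on_add[OF open_chart_image[OF c]
            vector_fieldsD[OF assms(1) c] vector_fieldsD[OF assms(2) c]]])
      (use c in \<open>auto simp: vf_rep_def linear_add[OF linear_chart_diff]\<close>)
qed

lemma vector_fields_scaleR:
  assumes "smooth_fun A h" "X \<in> vector_fields A"
  shows "(\<lambda>q. h q *\<^sub>R X q) \<in> vector_fields A"
  unfolding vector_fields_def
proof (intro CollectI ballI)
  fix c assume c: "c \<in> A"
  show "smooth_map_on (snd c ` fst c) (vf_rep A c (\<lambda>q. h q *\<^sub>R X q))"
    by (rule smooth_map_on_cong[OF open_chart_image[OF c] _ smooth_map_on_scaleR[OF open_chart_image[OF c]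
            smooth_funD[OF assms(1) c] vector_fieldsD[OF assms(2) c]]])
      (use c in \<open>auto simp: vf_rep_def linear_cmul[OF linear_chart_diff]\<close>)
qed

lemma vector_fields_zero: "(\<lambda>q. 0) \<in> vector_fields A"
  unfolding vector_fields_def
proof (intro CollectI ballI)
  fix c assume c: "c \<in> A"
  show "smooth_map_on (snd c ` fst c) (vf_rep A c (\<lambda>q. 0))"
    by (rule smooth_map_on_cong[OF open_chart_image[OF c] _ smooth_map_on_const[of _ 0]])
      (use c in \<open>auto simp: vf_rep_def linear_0[OF linear_chart_diff]\<close>)
qed

lemma vector_fields_diff:
  assumes "X \<in> vector_fields A" "Y \<in> vector_fields A"
  shows "(\<lambda>q. X q - Y q) \<in> vector_fields A"
  using vector_fields_add[OF assms(1) vector_fields_scaleR[OF smooth_fun_const[of "-1"] assms(2)]] by simp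

lemma vector_fields_sum:
  "(\<And>i. i \<in> I \<Longrightarrow> X i \<in> vector_fields A) \<Longrightarrow> (\<lambda>q. \<Sum>i\<in>I. X i q) \<in> vector_fields A"
  by (induction I rule: infinite_finite_induct) (auto intro: vector_fields_zero vector_fields_add)

lemma smooth_fun_dir_deriv:
  assumes "X \<in> vector_fields A" "smooth_fun A h"
  shows "smooth_fun A (dir_deriv A X h)"
  unfolding smooth_fun_def
proof
  fix c assume c: "c \<in> A"
  show "smooth_map_on (snd c ` fst c) (dir_deriv A X h \<circ> chart_inv c)"
    by (rule smooth_map_on_cong[OF open_chart_image[OF c] _ smooth_map_on_frechet_derivative_along[OF open_chart_image[OF c]
            smooth_funD[OF assms(2) c] vector_fieldsD[OF assms(1) c]]])
      (use c in \<open>auto simp: dir_deriv_in_chart[OF c _ assms(2)]\<close>)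
qed

lemma smooth_fun_has_derivative:
  assumes "smooth_fun A h"
  shows "(h \<circ> chart_inv (chart_at A p) has_derivative
    frechet_derivative (h \<circ> chart_inv (chart_at A p)) (at (snd (chart_at A p) p))) (at (snd (chart_at A p) p))"
  unfolding frechet_derivative_works[symmetric]
  using smooth_map_on_differentiable[OF smooth_funD[OF assms chart_at_in]] by auto

lemma dir_deriv_mult:
  assumes "smooth_fun A h" "smooth_fun A k"
  shows "dir_deriv A X (\<lambda>q. h q * k q) p = h p * dir_deriv A X k p + dir_deriv A X h p * k p"
  using frechet_derivative_at[OF has_derivative_mult[OF smooth_fun_has_derivative[OF assms(1)]
        smooth_fun_has_derivative[OF assms(2)], of p], symmetric]
  by (simp add: dir_deriv_def comp_def)

lemma dir_deriv_const [simp]: "dir_deriv A X (\<lambda>q. r) p = 0"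
  by (simp add: dir_deriv_def comp_def)

lemma dir_deriv_add:
  assumes "smooth_fun A h"
  shows "dir_deriv A (\<lambda>q. X q + Y q) h p = dir_deriv A X h p + dir_deriv A Y h p"
  using linear_add[OF has_derivative_linear[OF smooth_fun_has_derivative[OF assms]]] by (simp add: dir_deriv_def)

lemma dir_deriv_fun_add:
  assumes "smooth_fun A h" "smooth_fun A k"
  shows "dir_deriv A X (\<lambda>q. h q + k q) p = dir_deriv A X h p + dir_deriv A X k p"
  using frechet_derivative_at[OF has_derivative_add[OF smooth_fun_has_derivative[OF assms(1)]
        smooth_fun_has_derivative[OF assms(2)], of p], symmetric]
  by (simp add: dir_deriv_def comp_def)

lemma dir_deriv_fun_diff:
  assumes "smooth_fun A h" "smooth_fun A k"
  shows "dir_deriv A X (\<lambda>q. h q - k q) p = dir_deriv A X h p - dir_deriv A X k p"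
  using frechet_derivative_at[OF has_derivative_diff[OF smooth_fun_has_derivative[OF assms(1)]
        smooth_fun_has_derivative[OF assms(2)], of p], symmetric]
  by (simp add: dir_deriv_def comp_def)

text \<open>
Jacobi's identity, and with it the Bianchi identity, the skewness of the curvature operators with
respect to the metric and the tensoriality of the curvature in its third argument rest on this formula.
\<close>

lemma dir_deriv_lie_bracket:
  assumes X: "X \<in> vector_fields A" and Y: "Y \<in> vector_fields A" and h: "smooth_fun A h"
  shows "dir_deriv A (lie_bracket A X Y) h p =
    dir_deriv A X (dir_deriv A Y h) p - dir_deriv A Y (dir_deriv A X h) p"
proof -
  define c where "c = chart_at A p"
  let ?x = "snd c p" and ?H = "h \<circ> chart_inv c"
  have c: "c \<in> A" "p \<in> fst c" by (simp_all add: c_def)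
  note op = open_chart_image[OF c(1)] and xin = imageI[OF c(2), of "snd c"]
  have H: "smooth_map_on (snd c ` fst c) ?H" using smooth_funD[OF h c(1)] .
  have rep: "vf_rep A c Z ?x = Z p" for Z by (simp add: c_def)
  have second: "dir_deriv A Z (dir_deriv A W h) p =
      frechet_derivative ?H (at ?x) (frechet_derivative (vf_rep A c W) (at ?x) (Z p)) +
      frechet_derivative (\<lambda>y. frechet_derivative ?H (at y) (W p)) (at ?x) (Z p)"
    if W: "W \<in> vector_fields A" for Z W
  proof -
    have eq: "frechet_derivative ?H (at y) (vf_rep A c W y) = (dir_deriv A W h \<circ> chart_inv c) y"
      if "y \<in> snd c ` fst c" for y
      using that c by (auto simp: dir_deriv_in_chart[OF c(1) _ h])
    have diff: "(\<lambda>y. frechet_derivative ?H (at y) (vf_rep A c W y)) differentiable (at ?x)"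
      by (rule smooth_map_on_differentiable[OF smooth_map_on_frechet_derivative_along[OF op H vector_fieldsD[OF W c(1)]] xin])
    have "dir_deriv A Z (dir_deriv A W h) p = frechet_derivative (dir_deriv A W h \<circ> chart_inv c) (at ?x) (Z p)"
      by (simp add: dir_deriv_def[of A Z] c_def)
    also have "\<dots> = frechet_derivative (\<lambda>y. frechet_derivative ?H (at y) (vf_rep A c W y)) (at ?x) (Z p)"
      using frechet_derivative_transform_within_open[OF diff op xin eq] by (simp add: comp_def)
    finally show ?thesis
      using frechet_derivative_along_field[OF op xin H vector_fieldsD[OF W c(1)]] by (simp add: rep)
  qed
  have "dir_deriv A (lie_bracket A X Y) h p = frechet_derivative ?H (at ?x)
      (frechet_derivative (vf_rep A c Y) (at ?x) (X p) - frechet_derivative (vf_rep A c X) (at ?x) (Y p))"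
    by (simp add: dir_deriv_def lie_bracket_def Let_def c_def)
  also have "\<dots> = frechet_derivative ?H (at ?x) (frechet_derivative (vf_rep A c Y) (at ?x) (X p)) -
      frechet_derivative ?H (at ?x) (frechet_derivative (vf_rep A c X) (at ?x) (Y p))"
    by (rule linear_diff[OF linear_frechet_derivative[OF smooth_map_on_differentiable[OF H xin]]])
  finally show ?thesis
    using second[OF X, of Y] second[OF Y, of X] symmetric_second_frechet_derivative[OF op xin H, of "Y p" "X p"]
    by simp
qed

end


section \<open>Global extensions of local frames\<close>

context smooth_manifold
begin

text \<open>
Near a point of the chart domain of \<open>c\<close>, change coordinates to \<open>c\<close>.  Any other point has a
neighbourhood that avoids the image of \<open>K\<close>, because compact sets of a Hausdorff space are closed.
\<close>

lemma smooth_map_on_chart_if_compact_support: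
  assumes c: "c \<in> A" and d: "d \<in> A" and K: "compact K" "K \<subseteq> snd c ` fst c"
    and G: "smooth_map_on (snd c ` (fst c \<inter> fst d)) G"
    and inside: "\<And>q. q \<in> fst c \<Longrightarrow> q \<in> fst d \<Longrightarrow> F (snd d q) = G (snd c q)"
    and outside: "\<And>q. q \<in> fst d \<Longrightarrow> q \<notin> chart_inv c ` K \<Longrightarrow> F (snd d q) = 0"
  shows "smooth_map_on (snd d ` fst d) F"
proof (rule smooth_map_on_local)
  fix x assume "x \<in> snd d ` fst d"
  then obtain q where q: "q \<in> fst d" "x = snd d q" by auto
  show "\<exists>T. open T \<and> x \<in> T \<and> smooth_map_on T F"
  proof (cases "q \<in> fst c")
    case True
    let ?T = "snd d ` (fst d \<inter> fst c)"
    have "open ?T" using open_chart_image_Int[OF d open_chart_domain[OF c]] .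
    moreover have "smooth_map_on ?T (\<lambda>y. G ((snd c \<circ> chart_inv d) y))"
      by (rule smooth_map_on_compose[OF \<open>open ?T\<close> open_chart_image_Int[OF c open_chart_domain[OF d]]
            _ G compatible[OF d c]]) (use c d in auto)
    then have "smooth_map_on ?T F"
      by (rule smooth_map_on_cong[OF \<open>open ?T\<close>, rotated]) (use c d inside in auto)
    ultimately show ?thesis using True q by blast
  next
    case False
    have "compact (chart_inv c ` K)"
      using compact_continuous_image[OF continuous_on_subset[OF continuous_on_chart_inv[OF c] K(2)] K(1)] .
    then have op: "open (- (chart_inv c ` K))" by (simp add: compact_imp_closed open_Compl)
    let ?T = "snd d ` (fst d \<inter> - (chart_inv c ` K))"
    have "open ?T" using open_chart_image_Int[OF d op] .
    moreover have "smooth_map_on ?T F"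
      by (rule smooth_map_on_cong[OF \<open>open ?T\<close> _ smooth_map_on_const[of _ 0]]) (use outside in auto)
    moreover have "q \<notin> chart_inv c ` K" using False c K(2) by auto
    ultimately show ?thesis using q by blast
  qed
qed

definition extend_by_zero :: "('m, 'k) chart \<Rightarrow> (real ^ 'k \<Rightarrow> 'b::zero) \<Rightarrow> 'm \<Rightarrow> 'b" where
  "extend_by_zero c u q = (if q \<in> fst c then u (snd c q) else 0)"

lemma smooth_fun_extend_by_zero:
  assumes c: "c \<in> A" and K: "compact K" "K \<subseteq> snd c ` fst c"
    and u: "smooth_map_on (snd c ` fst c) u" and supp: "\<And>y. y \<notin> K \<Longrightarrow> u y = 0"
  shows "smooth_fun A (extend_by_zero c u)"
  unfolding smooth_fun_def
proof
  fix d assume d: "d \<in> A"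
  show "smooth_map_on (snd d ` fst d) (extend_by_zero c u \<circ> chart_inv d)"
  proof (rule smooth_map_on_chart_if_compact_support[OF c d K])
    show "smooth_map_on (snd c ` (fst c \<inter> fst d)) u" by (rule smooth_map_on_subset[OF u]) auto
    show "(extend_by_zero c u \<circ> chart_inv d) (snd d q) = 0" if "q \<in> fst d" "q \<notin> chart_inv c ` K" for q
      using that supp[of "snd c q"] c d by (force simp: extend_by_zero_def)
  qed (use d in \<open>auto simp: extend_by_zero_def\<close>)
qed

text \<open>
The fields \<open>E i\<close> are coordinate fields multiplied by the bump function \<open>\<phi>\<close>.  The components of a field
\<open>X\<close> must also be multiplied by \<open>\<phi>\<close> to become global functions, and this is why the expansion holds for
$\phi^2 X$.  It replaces the statement that tensors act locally.
\<close>

lemma local_frame: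
  obtains \<phi> :: "'m \<Rightarrow> real" and E :: "'k \<Rightarrow> 'm \<Rightarrow> real ^ 'k"
  where "smooth_fun A \<phi>" "\<phi> p = 1" "\<And>i. E i \<in> vector_fields A" "\<And>i. E i p = axis i 1"
    "\<And>X. X \<in> vector_fields A \<Longrightarrow> \<exists>a. (\<forall>i. smooth_fun A (a i)) \<and> (\<forall>i. a i p = X p $ i) \<and>
       (\<forall>q. (\<phi> q * \<phi> q) *\<^sub>R X q = (\<Sum>i\<in>UNIV. a i q *\<^sub>R E i q))"
proof -
  define c where "c = chart_at A p"
  have c: "c \<in> A" "p \<in> fst c" by (simp_all add: c_def)
  note op = open_chart_image[OF c(1)]
  obtain \<psi> :: "real ^ 'k \<Rightarrow> real" and K where \<psi>: "smooth_map_on UNIV \<psi>" "compact K" "K \<subseteq> snd c ` fst c"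
    "\<psi> (snd c p) = 1" "\<And>y. y \<notin> K \<Longrightarrow> \<psi> y = 0"
    using exists_smooth_bump[OF op imageI[OF c(2)]] by metis
  note \<psi>S = smooth_map_on_subset[OF \<psi>(1) subset_UNIV]
  define \<phi> where "\<phi> = extend_by_zero c \<psi>"
  define J where "J q = frechet_derivative (snd (chart_at A q) \<circ> chart_inv c) (at (snd c q))" for q
  define E where "E i q = \<phi> q *\<^sub>R J q (axis i 1)" for i q
  define a where "a X i = extend_by_zero c (\<lambda>y. \<psi> y * (vf_rep A c X y $ i))" for X i
  have linJ: "linear (J q)" if "q \<in> fst c" for q
    unfolding J_def using that c(1) by (intro linear_frechet_derivative transition_differentiable) auto
  have "smooth_fun A \<phi>"
    unfolding \<phi>_def by (rule smooth_fun_extend_by_zero[OF c(1) \<psi>(2,3) \<psi>S \<psi>(5)])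
  moreover have "\<phi> p = 1" using c \<psi>(4) by (simp add: \<phi>_def extend_by_zero_def)
  moreover have "E i \<in> vector_fields A" for i
    unfolding vector_fields_def
  proof (intro CollectI ballI)
    fix d assume d: "d \<in> A"
    let ?G = "\<lambda>y. \<psi> y *\<^sub>R frechet_derivative (snd d \<circ> chart_inv c) (at y) (axis i 1)"
    show "smooth_map_on (snd d ` fst d) (vf_rep A d (E i))"
    proof (rule smooth_map_on_chart_if_compact_support[OF c(1) d \<psi>(2,3)])
      show "smooth_map_on (snd c ` (fst c \<inter> fst d)) ?G"
        by (intro smooth_map_on_scaleR open_chart_image_Int c open_chart_domain d \<psi>S
            smooth_map_on_frechet_derivative compatible)
      show "vf_rep A d (E i) (snd d q) = ?G (snd c q)" if "q \<in> fst c" "q \<in> fst d" for q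
        using that c d chart_diff_cocycle[OF c(1) that(1) d that(2)]
        by (simp add: vf_rep_def E_def \<phi>_def extend_by_zero_def J_def linear_cmul[OF linear_chart_diff])
      show "vf_rep A d (E i) (snd d q) = 0" if "q \<in> fst d" "q \<notin> chart_inv c ` K" for q
      proof -
        have "\<phi> q = 0" using that \<psi>(5)[of "snd c q"] c by (force simp: \<phi>_def extend_by_zero_def)
        then show ?thesis using that d by (simp add: vf_rep_def E_def linear_0[OF linear_chart_diff])
      qed
    qed
  qed
  moreover have "E i p = axis i 1" for i
    using \<open>\<phi> p = 1\<close> derivative_chart_self[OF c] by (simp add: E_def J_def c_def)
  moreover have "\<exists>a. (\<forall>i. smooth_fun A (a i)) \<and> (\<forall>i. a i p = X p $ i) \<and>
       (\<forall>q. (\<phi> q * \<phi> q) *\<^sub>R X q = (\<Sum>i\<in>UNIV. a i q *\<^sub>R E i q))"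
    if X: "X \<in> vector_fields A" for X
  proof (intro exI[of _ "a X"] conjI allI)
    show "smooth_fun A (a X i)" for i
      unfolding a_def
    proof (rule smooth_fun_extend_by_zero[OF c(1) \<psi>(2,3)])
      have "smooth_map_on (snd c ` fst c) (\<lambda>y. vf_rep A c X y \<bullet> axis i 1)"
        by (intro smooth_map_on_bilinear[OF bounded_bilinear_inner] op vector_fieldsD[OF X c(1)] smooth_map_on_const)
      then show "smooth_map_on (snd c ` fst c) (\<lambda>y. \<psi> y * (vf_rep A c X y $ i))"
        by (intro smooth_map_on_mult op \<psi>S) (simp add: inner_axis)
    qed (use \<psi>(5) in auto)
    show "a X i p = X p $ i" for i
      using c \<psi>(4) by (simp add: a_def extend_by_zero_def) (simp add: c_def)
    show "(\<phi> q * \<phi> q) *\<^sub>R X q = (\<Sum>i\<in>UNIV. a X i q *\<^sub>R E i q)" for q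
    proof (cases "q \<in> fst c")
      case True
      have "(\<Sum>i\<in>UNIV. a X i q *\<^sub>R E i q) =
          (\<phi> q * \<phi> q) *\<^sub>R (\<Sum>i\<in>UNIV. (chart_diff A c q (X q) $ i) *\<^sub>R J q (axis i 1))"
        using True c by (simp add: a_def E_def \<phi>_def extend_by_zero_def vf_rep_def scaleR_sum_right mult_ac)
      also have "(\<Sum>i\<in>UNIV. (chart_diff A c q (X q) $ i) *\<^sub>R J q (axis i 1)) =
          J q (\<Sum>i\<in>UNIV. (chart_diff A c q (X q) $ i) *\<^sub>R axis i 1)"
        by (simp add: linear_sum[OF linJ[OF True]] linear_cmul[OF linJ[OF True]])
      also have "\<dots> = X q"
        using basis_expansion[of "chart_diff A c q (X q)"] inverse_chart_diff[OF c(1) True]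
        by (simp add: J_def scalar_mult_eq_scaleR)
      finally show ?thesis by simp
    qed (simp add: E_def \<phi>_def extend_by_zero_def)
  qed
  ultimately show thesis by (rule that[of \<phi> E])
qed

text \<open>
Testing on the bump function times a coordinate gives the components of the vector, once the term with
the derivative of the bump function has been removed by testing on the bump function itself.
\<close>

lemma vector_determined_by_derivations:
  assumes "\<And>h. smooth_fun A h \<Longrightarrow> dir_deriv A V h p = 0"
  shows "V p = 0"
proof -
  define c where "c = chart_at A p"
  have c: "c \<in> A" "p \<in> fst c" by (simp_all add: c_def)
  note op = open_chart_image[OF c(1)]
  let ?x = "snd c p"
  obtain \<psi> :: "real ^ 'k \<Rightarrow> real" and K where \<psi>: "smooth_map_on UNIV \<psi>" "compact K" "K \<subseteq> snd c ` fst c"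
    "\<psi> ?x = 1" "\<And>y. y \<notin> K \<Longrightarrow> \<psi> y = 0"
    using exists_smooth_bump[OF op imageI[OF c(2)]] by metis
  note \<psi>S = smooth_map_on_subset[OF \<psi>(1) subset_UNIV]
  have zero: "frechet_derivative (\<lambda>y. \<psi> y * u y) (at ?x) (V p) = 0"
    if u: "smooth_map_on UNIV u" for u :: "real ^ 'k \<Rightarrow> real"
  proof -
    let ?u = "\<lambda>y. \<psi> y * u y"
    have su: "smooth_map_on UNIV ?u" by (intro smooth_map_on_mult \<psi>(1) u) auto
    have "smooth_fun A (extend_by_zero c ?u)"
      by (rule smooth_fun_extend_by_zero[OF c(1) \<psi>(2,3) smooth_map_on_subset[OF su]]) (use \<psi>(5) in auto)
    from assms[OF this] have "frechet_derivative (extend_by_zero c ?u \<circ> chart_inv c) (at ?x) (V p) = 0"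
      by (simp add: dir_deriv_def c_def)
    moreover have "frechet_derivative ?u (at ?x) = frechet_derivative (extend_by_zero c ?u \<circ> chart_inv c) (at ?x)"
      by (rule frechet_derivative_transform_within_open[OF smooth_map_on_differentiable[OF su] op])
        (use c in \<open>auto simp: extend_by_zero_def\<close>)
    ultimately show ?thesis by simp
  qed
  have d\<psi>: "(\<psi> has_derivative frechet_derivative \<psi> (at ?x)) (at ?x)"
    using smooth_map_on_differentiable[OF \<psi>(1)] by (simp add: frechet_derivative_works[symmetric])
  have "V p $ i = 0" for i
  proof -
    have "((\<lambda>y. \<psi> y * (y \<bullet> axis i 1)) has_derivative
        (\<lambda>v. \<psi> ?x * (v \<bullet> axis i 1) + frechet_derivative \<psi> (at ?x) v * (?x \<bullet> axis i 1))) (at ?x)"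
      by (intro has_derivative_mult d\<psi> has_derivative_inner_left has_derivative_ident)
    from frechet_derivative_at[OF this, symmetric] zero[OF smooth_map_on_linear[OF bounded_linear_inner_left[of "axis i 1"]]]
    have "V p $ i + frechet_derivative \<psi> (at ?x) (V p) * (?x \<bullet> axis i 1) = 0"
      using \<psi>(4) by (simp add: inner_axis)
    then show ?thesis using zero[OF smooth_map_on_const[of _ 1]] by simp
  qed
  then show ?thesis by (simp add: vec_eq_iff)
qed

lemma exists_vector_field: obtains X where "X \<in> vector_fields A" "X p = x"
proof -
  obtain E where E: "\<And>i. E i \<in> vector_fields A" "\<And>i. E i p = axis i 1"
    by (rule local_frame[of p]) blast
  show thesis
  proof (rule that)
    show "(\<lambda>q. \<Sum>i\<in>UNIV. (x $ i) *\<^sub>R E i q) \<in> vector_fields A"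
      by (intro vector_fields_sum vector_fields_scaleR smooth_fun_const E)
    show "(\<Sum>i\<in>UNIV. (x $ i) *\<^sub>R E i p) = x"
      using basis_expansion[of x] by (simp add: E scalar_mult_eq_scaleR)
  qed
qed

text \<open>
An additive map that is linear over smooth functions cannot distinguish \<open>X\<close> from $\phi^2X$, and hence
sees only the coefficients of \<open>X\<close> in the local frame at \<open>p\<close>.
\<close>

lemma tensorial_depends_on_value:
  fixes T :: "('m \<Rightarrow> real ^ 'k) \<Rightarrow> 'b::real_vector"
  assumes add: "\<And>X Y. X \<in> vector_fields A \<Longrightarrow> Y \<in> vector_fields A \<Longrightarrow> T (\<lambda>q. X q + Y q) = T X + T Y"
    and scale: "\<And>h X. smooth_fun A h \<Longrightarrow> X \<in> vector_fields A \<Longrightarrow> T (\<lambda>q. h q *\<^sub>R X q) = h p *\<^sub>R T X"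
    and X: "X \<in> vector_fields A" and Y: "Y \<in> vector_fields A" and eq: "X p = Y p"
  shows "T X = T Y"
proof -
  obtain \<phi> E where \<phi>: "smooth_fun A \<phi>" "\<phi> p = 1"
    and E: "\<And>i. E i \<in> vector_fields A" "\<And>i. E i p = axis i 1"
    and expand: "\<And>X. X \<in> vector_fields A \<Longrightarrow> \<exists>a. (\<forall>i. smooth_fun A (a i)) \<and> (\<forall>i. a i p = X p $ i) \<and>
       (\<forall>q. (\<phi> q * \<phi> q) *\<^sub>R X q = (\<Sum>i\<in>UNIV. a i q *\<^sub>R E i q))"
    by (rule local_frame[of p]) (rule that; assumption)
  have T0: "T (\<lambda>q. 0) = 0" using scale[OF smooth_fun_const[of 0] X] by simp
  have sum: "T (\<lambda>q. \<Sum>i\<in>I. Z i q) = (\<Sum>i\<in>I. T (Z i))"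
    if "\<And>i. Z i \<in> vector_fields A" for Z and I :: "'k set"
    by (induction I rule: infinite_finite_induct) (use that in \<open>auto simp: T0 add vector_fields_sum\<close>)
  have "T Z = (\<Sum>i\<in>UNIV. (Z p $ i) *\<^sub>R T (E i))" if Z: "Z \<in> vector_fields A" for Z
  proof -
    obtain a where a: "\<And>i. smooth_fun A (a i)" "\<And>i. a i p = Z p $ i"
       "\<And>q. (\<phi> q * \<phi> q) *\<^sub>R Z q = (\<Sum>i\<in>UNIV. a i q *\<^sub>R E i q)"
      using expand[OF Z] by blast
    have "T Z = T (\<lambda>q. (\<phi> q * \<phi> q) *\<^sub>R Z q)"
      using scale[OF smooth_fun_mult[OF \<phi>(1) \<phi>(1)] Z] \<phi>(2) by simp
    also have "\<dots> = (\<Sum>i\<in>UNIV. T (\<lambda>q. a i q *\<^sub>R E i q))"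
      unfolding a(3) by (intro sum vector_fields_scaleR a E)
    also have "\<dots> = (\<Sum>i\<in>UNIV. (Z p $ i) *\<^sub>R T (E i))"
      by (simp add: scale a E)
    finally show ?thesis .
  qed
  then show ?thesis using X Y eq by metis
qed

end


section \<open>Frames and traces for an inner product\<close>

locale inner_product_form =
  fixes G :: "real ^ 'k \<Rightarrow> real ^ 'k \<Rightarrow> real"
  assumes bilinear: "bilinear G"
    and sym: "G v w = G w v"
    and pos: "v \<noteq> 0 \<Longrightarrow> G v v > 0"
begin

lemmas form_simps = bilinear_ladd[OF bilinear] bilinear_radd[OF bilinear]
  bilinear_lsub[OF bilinear] bilinear_rsub[OF bilinear]
  bilinear_lmul[OF bilinear] bilinear_rmul[OF bilinear]
  bilinear_lneg[OF bilinear] bilinear_rneg[OF bilinear]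
  bilinear_lzero[OF bilinear] bilinear_rzero[OF bilinear]

lemma linear_left: "linear (\<lambda>v. G v w)" and linear_right: "linear (G v)"
  using bilinear by (auto simp: bilinear_def)

lemma sum_left: "G (\<Sum>i\<in>I. v i) w = (\<Sum>i\<in>I. G (v i) w)"
  by (rule linear_sum[OF linear_left])

lemma sum_right: "G w (\<Sum>i\<in>I. v i) = (\<Sum>i\<in>I. G w (v i))"
  by (rule linear_sum[OF linear_right])

lemma nondegenerate: "(\<And>w. G u w = G v w) \<Longrightarrow> u = v"
  using pos[of "u - v"] by (fastforce simp: form_simps)

definition orthonormal :: "('k \<Rightarrow> real ^ 'k) \<Rightarrow> bool" where
  "orthonormal e \<longleftrightarrow> (\<forall>i j. G (e i) (e j) = (if i = j then 1 else 0))"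

text \<open>
The Gram-Schmidt process, one vector at a time.
\<close>

lemma exists_orthonormal: "\<exists>e. orthonormal e"
proof -
  have "\<exists>e::nat \<Rightarrow> real ^ 'k. \<forall>i<m. \<forall>j<m. G (e i) (e j) = (if i = j then 1 else 0)"
    if "m \<le> CARD('k)" for m
    using that
  proof (induction m)
    case (Suc m)
    then obtain e :: "nat \<Rightarrow> real ^ 'k"
      where e: "\<And>i j. i < m \<Longrightarrow> j < m \<Longrightarrow> G (e i) (e j) = (if i = j then 1 else 0)"
      by auto
    have "dim (e ` {..<m}) \<le> card (e ` {..<m})" by (rule dim_le_card') simp
    also have "\<dots> \<le> m" using card_image_le[of "{..<m}" e] by simp
    also have "\<dots> < dim (UNIV :: (real ^ 'k) set)" using Suc.prems by simp
    finally have "span (e ` {..<m}) \<noteq> UNIV" by (metis dim_span less_irrefl)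
    then obtain v where v: "v \<notin> span (e ` {..<m})" by blast
    define w where "w = v - (\<Sum>i<m. G v (e i) *\<^sub>R e i)"
    have "w \<noteq> 0"
    proof
      assume "w = 0"
      then have "v = (\<Sum>i<m. G v (e i) *\<^sub>R e i)" by (simp add: w_def)
      also have "\<dots> \<in> span (e ` {..<m})" by (intro span_sum span_scale span_base) auto
      finally show False using v by simp
    qed
    then have w0: "G w w > 0" by (rule pos)
    have orth: "G w (e j) = 0" if "j < m" for j
    proof -
      have "(\<Sum>i<m. G v (e i) * G (e i) (e j)) = (\<Sum>i<m. if i = j then G v (e j) else 0)"
        using e that by (intro sum.cong) auto
      then show ?thesis using that by (simp add: w_def form_simps sum_left)
    qed
    define e' where "e' = e(m := (1 / sqrt (G w w)) *\<^sub>R w)"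
    have "G (e' i) (e' j) = (if i = j then 1 else 0)" if "i < Suc m" "j < Suc m" for i j
    proof -
      have orth': "G (e j) w = 0" if "j < m" for j using orth[OF that] sym by simp
      show ?thesis using that w0 by (auto simp: e'_def form_simps less_Suc_eq orth orth' e)
    qed
    then show ?case by blast
  qed simp
  from this[of "CARD('k)"] obtain e :: "nat \<Rightarrow> real ^ 'k"
    where e: "\<And>i j. i < CARD('k) \<Longrightarrow> j < CARD('k) \<Longrightarrow> G (e i) (e j) = (if i = j then 1 else 0)"
    by auto
  obtain b where b: "bij_betw b (UNIV :: 'k set) {0..<CARD('k)}"
    using ex_bij_betw_finite_nat[of "UNIV :: 'k set"] by auto
  have "b i < CARD('k)" "b i = b j \<longleftrightarrow> i = j" for i j
    using b by (auto simp: bij_betw_def inj_on_def)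
  then have "orthonormal (\<lambda>i. e (b i))" by (auto simp: orthonormal_def e)
  then show ?thesis by blast
qed

text \<open>
The matrix with columns \<open>e i\<close> has the matrix of the functionals \<open>G (e i)\<close> as left inverse.  For square
matrices it is also a right inverse, and this is the expansion.
\<close>

lemma orthonormal_expansion:
  assumes "orthonormal e"
  shows "(\<Sum>i\<in>UNIV. G v (e i) *\<^sub>R e i) = v"
proof -
  let ?E = "(\<chi> i j. e j $ i) :: real ^ 'k ^ 'k" and ?M = "(\<chi> i j. G (e i) (axis j 1)) :: real ^ 'k ^ 'k"
  have M: "(\<Sum>k\<in>UNIV. G (e i) (axis k 1) * u $ k) = G (e i) u" for i u
  proof -
    have "G (e i) u = G (e i) (\<Sum>k\<in>UNIV. (u $ k) *\<^sub>R axis k 1)"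
      using basis_expansion[of u] by (simp add: scalar_mult_eq_scaleR)
    then show ?thesis by (simp add: sum_right form_simps mult.commute)
  qed
  have "?M ** ?E = mat 1"
    using assms by (simp add: vec_eq_iff matrix_matrix_mult_def M mat_def orthonormal_def)
  then have "?E ** ?M = mat 1" by (simp add: matrix_left_right_inverse)
  then have "?E *v (?M *v v) = v" by (simp add: matrix_vector_mul_assoc)
  moreover have "?M *v v = (\<chi> i. G (e i) v)" by (simp add: matrix_vector_mult_def M)
  ultimately have "?E *v (\<chi> i. G (e i) v) = v" by simp
  then show ?thesis
    by (simp add: vec_eq_iff matrix_vector_mult_def sym[of v] mult.commute)
qed

lemma endo_trace_orthonormal:
  assumes e: "orthonormal e" and L: "linear L"
  shows "endo_trace L = (\<Sum>i\<in>UNIV. G (L (e i)) (e i))"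
proof -
  have "endo_trace L = (\<Sum>j\<in>UNIV. L (axis j 1) $ j)"
    by (simp add: endo_trace_def trace_def matrix_def)
  also have "\<dots> = (\<Sum>j\<in>UNIV. \<Sum>i\<in>UNIV. G (L (axis j 1)) (e i) * e i $ j)"
    by (intro sum.cong refl, subst orthonormal_expansion[OF e, symmetric]) simp
  also have "\<dots> = (\<Sum>i\<in>UNIV. \<Sum>j\<in>UNIV. G (L (axis j 1)) (e i) * e i $ j)"
    by (rule sum.swap)
  also have "\<dots> = (\<Sum>i\<in>UNIV. G (L (e i)) (e i))"
  proof (intro sum.cong refl)
    fix i
    have "L (e i) = L (\<Sum>j\<in>UNIV. (e i $ j) *\<^sub>R axis j 1)"
      using basis_expansion[of "e i"] by (simp add: scalar_mult_eq_scaleR)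
    then show "(\<Sum>j\<in>UNIV. G (L (axis j 1)) (e i) * e i $ j) = G (L (e i)) (e i)"
      by (simp add: linear_sum[OF L] linear_cmul[OF L] sum_left form_simps mult.commute)
  qed
  finally show ?thesis .
qed

lemma riesz_representation:
  assumes "linear \<omega>"
  shows "\<exists>!w. \<forall>y. G w y = \<omega> y"
proof -
  obtain e where e: "orthonormal e" using exists_orthonormal by blast
  have "G (\<Sum>i\<in>UNIV. \<omega> (e i) *\<^sub>R e i) y = \<omega> y" for y
  proof -
    have "\<omega> y = \<omega> (\<Sum>i\<in>UNIV. G y (e i) *\<^sub>R e i)" by (simp add: orthonormal_expansion[OF e])
    then show ?thesis
      by (simp add: linear_sum[OF assms] linear_cmul[OF assms] sum_left form_simps sym[of y] mult.commute)
  qed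
  then show ?thesis using nondegenerate by metis
qed

lemma orthonormal_parseval:
  assumes "orthonormal e"
  shows "(\<Sum>i\<in>UNIV. G u (e i) * G v (e i)) = G u v"
proof -
  have "G u v = G u (\<Sum>i\<in>UNIV. G v (e i) *\<^sub>R e i)" by (simp add: orthonormal_expansion[OF assms])
  then show ?thesis by (simp add: sum_right form_simps mult.commute)
qed

end

lemma riemannian_metric_inner_product_form:
  "riemannian_metric A g \<Longrightarrow> inner_product_form (g p)"
  by unfold_locales (auto simp: riemannian_metric_def)

lemma endo_trace_cyclic:
  assumes "linear L" "linear M"
  shows "endo_trace (\<lambda>v. L (M v)) = endo_trace (\<lambda>v. M (L v))"
  unfolding endo_trace_def matrix_compose[OF assms(2,1), unfolded comp_def]
    matrix_compose[OF assms, unfolded comp_def]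
  by (rule trace_mul_sym)

lemma endo_trace_rank_one:
  assumes "linear \<omega>"
  shows "endo_trace (\<lambda>v. \<omega> v *\<^sub>R u) = \<omega> u"
proof -
  have "\<omega> u = \<omega> (\<Sum>j\<in>UNIV. (u $ j) *\<^sub>R axis j 1)"
    using basis_expansion[of u] by (simp add: scalar_mult_eq_scaleR)
  then show ?thesis
    by (simp add: endo_trace_def trace_def matrix_def linear_sum[OF assms] linear_cmul[OF assms] mult.commute)
qed

lemma endo_trace_add: "endo_trace (\<lambda>v. L v + M v) = endo_trace L + endo_trace M"
  and endo_trace_diff: "endo_trace (\<lambda>v. L v - M v) = endo_trace L - endo_trace M"
  and endo_trace_minus: "endo_trace (\<lambda>v. - L v) = - endo_trace L"
  and endo_trace_scaleR: "endo_trace (\<lambda>v. r *\<^sub>R L v) = r * endo_trace L"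
  and endo_trace_ident: "endo_trace (\<lambda>v::real ^ 'k::finite. v) = real CARD('k)"
  by (simp_all add: endo_trace_def trace_def matrix_def sum.distrib sum_subtractf sum_negf sum_distrib_left)


section \<open>Algebraic curvature tensors\<close>

text \<open>
The pointwise symmetries of the Riemann tensor; everything after the Ricci identity happens in this
setting.
\<close>

locale algebraic_curvature = inner_product_form G
  for G :: "real ^ 'k \<Rightarrow> real ^ 'k \<Rightarrow> real" +
  fixes S :: "real ^ 'k \<Rightarrow> real ^ 'k \<Rightarrow> real ^ 'k \<Rightarrow> real ^ 'k"
  assumes lin1: "linear (\<lambda>x. S x y z)" and lin3: "linear (S x y)"
    and skew: "S y x z = - S x y z"
    and metric_skew: "G (S x y z) w = - G z (S x y w)"
    and bianchi: "S x y z + S y z x + S z x y = 0"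
begin

definition Ric :: "real ^ 'k \<Rightarrow> real ^ 'k \<Rightarrow> real" where
  "Ric x y = endo_trace (\<lambda>z. S z x y)"

text \<open>
The usual octahedron argument: a combination of four Bianchi identities.
\<close>

lemma pair_symmetry: "G (S x y z) w = G (S z w x) y"
proof -
  have cyc: "G (S a b c) d + G (S b c a) d + G (S c a b) d = 0" for a b c d
    using bianchi[of a b c] by (metis bilinear_ladd[OF bilinear] bilinear_lzero[OF bilinear])
  have s12: "G (S b a c) d = - G (S a b c) d" for a b c d
    by (simp add: skew[of b a] form_simps)
  have s34: "G (S a b d) c = - G (S a b c) d" for a b c d
    using metric_skew[of a b d c] sym by simp
  show ?thesis
    using cyc[of x y z w] cyc[of y z w x] cyc[of z w x y] cyc[of w x y z]
      s34[of x y z w] s34[of y z x w] s34[of z w x y] s34[of w x z y]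
      s12[of x z w y] s34[of z x w y] s12[of y w x z] s34[of w y x z]
    by linarith
qed

lemma Ric_sym: "Ric x y = Ric y x"
proof -
  obtain e where e: "orthonormal e" using exists_orthonormal by blast
  have "G (S (e i) x y) (e i) = G (S (e i) y x) (e i)" for i
    using pair_symmetry[of "e i" x y "e i"] metric_skew[of y "e i" "e i" x] skew[of "e i" y x] sym
    by (simp add: form_simps)
  then show ?thesis
    by (simp add: Ric_def endo_trace_orthonormal[OF e lin1])
qed

lemma linear_Ric_right: "linear (Ric x)"
  by (rule linearI)
    (simp_all add: Ric_def linear_add[OF lin3] linear_cmul[OF lin3] endo_trace_add endo_trace_scaleR)

text \<open>
This is the heart of the proof.  The commutation hypothesis is what holds for the complex structure of
a Kaehler manifold; here \<open>f\<close> may be degenerate and \<open>f\<^sup>2\<close> is arbitrary.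
\<close>

lemma trace_star:
  assumes f: "linear f" and f_skew: "\<And>v w. G (f v) w = - G v (f w)"
    and commute: "\<And>x y z. S x y (f z) = f (S x y z)"
  shows "endo_trace (\<lambda>z. S x (f y) (f z)) = - 2 * Ric x (f (f y))"
proof -
  \<comment> \<open>the Bianchi identity separates the two contributions to the trace\<close>
  have b: "S x (f y) (f z) = - S (f y) (f z) x - S (f z) x (f y)" for z
    using bianchi[of x "f y" "f z"] by (simp add: eq_neg_iff_add_eq_0 algebra_simps)
  \<comment> \<open>pair symmetry moves both copies of \<open>f\<close> into the arguments where \<open>S\<close> commutes with \<open>f\<close>\<close>
  have "S (f y) (f z) x = - S (f (f y)) z x" for z
  proof (rule nondegenerate)
    fix w
    have "G (S (f y) (f z) x) w = G (S x w (f y)) (f z)" by (rule pair_symmetry)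
    also have "\<dots> = - G (S x w (f (f y))) z" by (simp add: commute f_skew)
    also have "\<dots> = - G (S (f (f y)) z x) w" by (simp add: pair_symmetry[of x w])
    finally show "G (S (f y) (f z) x) w = G (- S (f (f y)) z x) w" by (simp add: form_simps)
  qed
  then have 1: "endo_trace (\<lambda>z. S (f y) (f z) x) = Ric x (f (f y))"
  proof -
    have "endo_trace (\<lambda>z. S (f y) (f z) x) = endo_trace (\<lambda>z. S z (f (f y)) x)"
      by (simp only: \<open>\<And>z. S (f y) (f z) x = - S (f (f y)) z x\<close> skew[symmetric])
    also have "\<dots> = Ric (f (f y)) x" by (simp only: Ric_def)
    also have "\<dots> = Ric x (f (f y))" by (rule Ric_sym)
    finally show ?thesis .
  qed
  have "endo_trace (\<lambda>z. S (f z) x (f y)) = endo_trace (\<lambda>z. f (S z x (f y)))"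
    by (rule endo_trace_cyclic[OF lin1 f])
  then have 2: "endo_trace (\<lambda>z. S (f z) x (f y)) = Ric x (f (f y))"
    by (simp add: Ric_def commute)
  show ?thesis unfolding b by (simp add: endo_trace_diff endo_trace_minus 1 2)
qed

text \<open>
The added term is \<open>c\<close> times the curvature tensor of constant curvature \<open>1\<close>.
\<close>

lemma shifted_algebraic_curvature:
  "algebraic_curvature G (\<lambda>x y z. S x y z + c *\<^sub>R (G y z *\<^sub>R x - G x z *\<^sub>R y))"
proof (intro algebraic_curvature.intro inner_product_form_axioms algebraic_curvature_axioms.intro)
  fix x y z w
  let ?T = "\<lambda>x y z. S x y z + c *\<^sub>R (G y z *\<^sub>R x - G x z *\<^sub>R y)"
  show "linear (\<lambda>x. ?T x y z)"
    by (rule linearI) (simp_all add: linear_add[OF lin1] linear_cmul[OF lin1] form_simps algebra_simps)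
  show "linear (?T x y)"
    by (rule linearI) (simp_all add: linear_add[OF lin3] linear_cmul[OF lin3] form_simps algebra_simps)
  show "?T y x z = - ?T x y z"
    by (simp add: skew[of y x] algebra_simps)
  show "G (?T x y z) w = - G z (?T x y w)"
    using metric_skew[of x y z w] by (simp add: form_simps sym algebra_simps)
  show "?T x y z + ?T y z x + ?T z x y = 0"
    using bianchi[of x y z] sym[of x y] sym[of y z] sym[of z x] by (simp add: algebra_simps)
qed

lemma Ric_shifted:
  "endo_trace (\<lambda>z. S z x y + c *\<^sub>R (G x y *\<^sub>R z - G z y *\<^sub>R x)) =
   Ric x y + c * (real CARD('k) - 1) * G x y"
  unfolding endo_trace_add endo_trace_scaleR endo_trace_diff endo_trace_ident
    endo_trace_rank_one[OF linear_left] Ric_def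
  by (simp add: algebra_simps)

text \<open>
The terms with \<open>c\<close> in \<open>ricci_identity\<close> cancel the commutator of \<open>f\<close> with \<open>c\<close> times the curvature tensor
of constant curvature \<open>1\<close>, so the tensor shifted by the latter commutes with \<open>f\<close>.  It annihilates \<open>\<xi>\<close>: its value there lies in the kernel of \<open>f\<close>, thus is a
multiple of \<open>\<xi>\<close>, and is orthogonal to \<open>\<xi>\<close> by skewness.
\<close>

lemma half_trace_star:
  assumes f: "linear f" and f_skew: "\<And>v w. G (f v) w = - G v (f w)"
    and ricci_identity: "\<And>x y z. S x y (f z) =
      f (S x y z) + c *\<^sub>R (G (f y) z *\<^sub>R x - G (f x) z *\<^sub>R y - G x z *\<^sub>R f y + G y z *\<^sub>R f x)"
    and f_xi: "f \<xi> = 0" and kernel: "\<And>u. f u = 0 \<Longrightarrow> u = G \<xi> u *\<^sub>R \<xi>" and xi: "G \<xi> \<xi> = 1"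
    and ff: "\<And>y. f (f y) = - Q y + G \<xi> y *\<^sub>R \<xi>"
  shows "1 / 2 * endo_trace (\<lambda>z. S x (f y) (f z)) =
    Ric x (Q y) + c * ((real CARD('k) - 2) * G x (Q y) + G \<xi> x * G \<xi> y)"
proof -
  define T where "T = (\<lambda>x y z. S x y z + c *\<^sub>R (G y z *\<^sub>R x - G x z *\<^sub>R y))"
  interpret T: algebraic_curvature G T
    unfolding T_def by (rule shifted_algebraic_curvature)
  have commute: "T x y (f z) = f (T x y z)" for x y z
    by (simp add: T_def ricci_identity linear_add[OF f] linear_diff[OF f] linear_cmul[OF f] f_skew algebra_simps)
  have T_xi: "T x y \<xi> = 0" for x y
  proof -
    have "f (T x y \<xi>) = 0" using commute[of x y \<xi>] by (simp add: f_xi linear_0[OF T.lin3])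
    then have "T x y \<xi> = G \<xi> (T x y \<xi>) *\<^sub>R \<xi>" by (rule kernel)
    moreover have "G \<xi> (T x y \<xi>) = 0" using T.metric_skew[of x y \<xi> \<xi>] sym[of \<xi>] by simp
    ultimately show ?thesis by simp
  qed
  have Ric_T: "T.Ric x y = Ric x y + c * (real CARD('k) - 1) * G x y" for x y
    unfolding T.Ric_def Ric_shifted[symmetric] by (simp add: T_def)
  have "T.Ric x \<xi> = 0" by (simp add: T.Ric_def T_xi endo_trace_def trace_def matrix_def)
  then have "T.Ric x (f (f y)) = - T.Ric x (Q y)"
    by (simp add: ff linear_add[OF T.linear_Ric_right] linear_diff[OF T.linear_Ric_right] linear_neg[OF T.linear_Ric_right]
        linear_cmul[OF T.linear_Ric_right])
  then have tr_T: "endo_trace (\<lambda>z. T x (f y) (f z)) = 2 * T.Ric x (Q y)"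
    using T.trace_star[OF f f_skew commute] by simp
  have "S x (f y) (f z) = T x (f y) (f z) - c *\<^sub>R (G (f y) (f z) *\<^sub>R x - G x (f z) *\<^sub>R f y)" for z
    by (simp add: T_def)
  moreover have "linear (\<lambda>z. G (f y) (f z))" "linear (\<lambda>z. G x (f z))"
    using linear_compose[OF f linear_right] by (auto simp: comp_def)
  ultimately have "endo_trace (\<lambda>z. S x (f y) (f z)) =
      2 * T.Ric x (Q y) - c * (G (f y) (f x) - G x (f (f y)))"
    by (simp add: endo_trace_diff endo_trace_scaleR tr_T endo_trace_rank_one)
  also have "G (f y) (f x) = - G x (f (f y))" using f_skew[of x "f y"] sym by simp
  also have "G x (f (f y)) = - G x (Q y) + G \<xi> x * G \<xi> y"
    by (simp add: ff form_simps sym[of x \<xi>])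
  finally show ?thesis by (simp add: Ric_T algebra_simps)
qed

end


section \<open>The Levi-Civita curvature tensor\<close>

locale levi_civita_manifold = smooth_manifold A
  for A :: "('m::{t2_space, second_countable_topology}, 'k::finite) chart set" +
  fixes g :: "'m \<Rightarrow> real ^ 'k \<Rightarrow> real ^ 'k \<Rightarrow> real"
    and D :: "('m \<Rightarrow> real ^ 'k) \<Rightarrow> ('m \<Rightarrow> real ^ 'k) \<Rightarrow> 'm \<Rightarrow> real ^ 'k"
  assumes g_metric: "riemannian_metric A g"
    and D_levi_civita: "levi_civita A g D"
begin

abbreviation "VF \<equiv> vector_fields A"
abbreviation "R \<equiv> curvature A D"
abbreviation "br \<equiv> lie_bracket A"

lemma D_affine: "affine_connection A D"
  using D_levi_civita by (simp add: levi_civita_def)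

lemma D_field: "X \<in> VF \<Longrightarrow> Y \<in> VF \<Longrightarrow> D X Y \<in> VF"
  using D_affine by (simp add: affine_connection_def)

lemma D_add_left: "X \<in> VF \<Longrightarrow> Y \<in> VF \<Longrightarrow> Z \<in> VF \<Longrightarrow> D (\<lambda>p. X p + Y p) Z = (\<lambda>p. D X Z p + D Y Z p)"
  using D_affine by (simp add: affine_connection_def)

lemma D_add_right: "X \<in> VF \<Longrightarrow> Y \<in> VF \<Longrightarrow> Z \<in> VF \<Longrightarrow> D Z (\<lambda>p. X p + Y p) = (\<lambda>p. D Z X p + D Z Y p)"
  using D_affine by (simp add: affine_connection_def)

lemma D_scale_left: "X \<in> VF \<Longrightarrow> Y \<in> VF \<Longrightarrow> smooth_fun A h \<Longrightarrow> D (\<lambda>p. h p *\<^sub>R X p) Y = (\<lambda>p. h p *\<^sub>R D X Y p)"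
  using D_affine unfolding affine_connection_def by blast

lemma D_scale_right: "X \<in> VF \<Longrightarrow> Y \<in> VF \<Longrightarrow> smooth_fun A h \<Longrightarrow>
    D X (\<lambda>p. h p *\<^sub>R Y p) = (\<lambda>p. dir_deriv A X h p *\<^sub>R Y p + h p *\<^sub>R D X Y p)"
  using D_affine unfolding affine_connection_def by blast

lemma D_minus_left: "X \<in> VF \<Longrightarrow> Z \<in> VF \<Longrightarrow> D (\<lambda>p. - X p) Z = (\<lambda>p. - D X Z p)"
  using D_scale_left[OF _ _ smooth_fun_const[of "-1"], of X Z] by simp

lemma D_minus_right: "X \<in> VF \<Longrightarrow> Z \<in> VF \<Longrightarrow> D Z (\<lambda>p. - X p) = (\<lambda>p. - D Z X p)"
  using D_scale_right[OF _ _ smooth_fun_const[of "-1"], of Z X] by simp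

lemma vector_fields_minus: "X \<in> VF \<Longrightarrow> (\<lambda>p. - X p) \<in> VF"
  using vector_fields_scaleR[OF smooth_fun_const[of "-1"], of X] by simp

lemma D_diff_left: "X \<in> VF \<Longrightarrow> Y \<in> VF \<Longrightarrow> Z \<in> VF \<Longrightarrow> D (\<lambda>p. X p - Y p) Z = (\<lambda>p. D X Z p - D Y Z p)"
  using D_add_left[of X "\<lambda>p. - Y p" Z] by (simp add: D_minus_left vector_fields_minus)

lemma D_diff_right: "X \<in> VF \<Longrightarrow> Y \<in> VF \<Longrightarrow> Z \<in> VF \<Longrightarrow> D Z (\<lambda>p. X p - Y p) = (\<lambda>p. D Z X p - D Z Y p)"
  using D_add_right[of X "\<lambda>p. - Y p" Z] by (simp add: D_minus_right vector_fields_minus)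

lemma lie_bracket_torsion_free: "X \<in> VF \<Longrightarrow> Y \<in> VF \<Longrightarrow> br X Y = (\<lambda>p. D X Y p - D Y X p)"
  using D_levi_civita by (simp add: levi_civita_def fun_eq_iff)

lemma lie_bracket_field: "X \<in> VF \<Longrightarrow> Y \<in> VF \<Longrightarrow> br X Y \<in> VF"
  by (simp add: lie_bracket_torsion_free vector_fields_diff D_field)

lemma dir_deriv_metric: "X \<in> VF \<Longrightarrow> Y \<in> VF \<Longrightarrow> Z \<in> VF \<Longrightarrow>
    dir_deriv A X (\<lambda>q. g q (Y q) (Z q)) p = g p (D X Y p) (Z p) + g p (Y p) (D X Z p)"
  using D_levi_civita by (simp add: levi_civita_def)

lemma smooth_fun_metric: "Y \<in> VF \<Longrightarrow> Z \<in> VF \<Longrightarrow> smooth_fun A (\<lambda>q. g q (Y q) (Z q))"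
  using g_metric by (simp add: riemannian_metric_def)

lemma inner_product_form_metric: "inner_product_form (g p)"
  using g_metric by (rule riemannian_metric_inner_product_form)

lemmas g_simps = inner_product_form.form_simps[OF inner_product_form_metric]
lemmas g_sym = inner_product_form.sym[OF inner_product_form_metric]

text \<open>
Both sides are compared as derivations of smooth functions, where Jacobi's identity is the one for
commutators.  This avoids any calculation with brackets in coordinates.
\<close>

lemma jacobi:
  assumes [simp]: "X \<in> VF" "Y \<in> VF" "Z \<in> VF"
  shows "br X (br Y Z) p + br Y (br Z X) p + br Z (br X Y) p = 0"
proof -
  let ?V = "\<lambda>q. br X (br Y Z) q + br Y (br Z X) q + br Z (br X Y) q"
  have fn: "dir_deriv A (br U W) h = (\<lambda>q. dir_deriv A U (dir_deriv A W h) q - dir_deriv A W (dir_deriv A U h) q)"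
    if "U \<in> VF" "W \<in> VF" "smooth_fun A h" for U W h
    using dir_deriv_lie_bracket[OF that] by auto
  have "dir_deriv A ?V h p = 0" if [simp]: "smooth_fun A h" for h
    by (simp add: dir_deriv_add fn lie_bracket_field smooth_fun_dir_deriv dir_deriv_fun_diff)
  then have "?V p = 0" by (rule vector_determined_by_derivations)
  then show ?thesis .
qed

lemma curvature_skew:
  assumes [simp]: "X \<in> VF" "Y \<in> VF" "Z \<in> VF"
  shows "R Y X Z p = - R X Y Z p"
proof -
  have "br Y X = (\<lambda>p. - br X Y p)" by (simp add: lie_bracket_torsion_free)
  then show ?thesis by (simp add: curvature_def D_minus_left lie_bracket_field)
qed

lemma curvature_bianchi:
  assumes [simp]: "X \<in> VF" "Y \<in> VF" "Z \<in> VF"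
  shows "R X Y Z p + R Y Z X p + R Z X Y p = 0"
proof -
  have *: "br U (br V W) p = D U (D V W) p - D U (D W V) p - D (br V W) U p"
    if [simp]: "U \<in> VF" "V \<in> VF" "W \<in> VF" for U V W
  proof -
    have "br U (br V W) p = D U (br V W) p - D (br V W) U p"
      using lie_bracket_torsion_free[of U "br V W"] by (simp add: lie_bracket_field)
    moreover have "D U (br V W) p = D U (D V W) p - D U (D W V) p"
      by (simp add: lie_bracket_torsion_free D_diff_right D_field)
    ultimately show ?thesis by simp
  qed
  show ?thesis using jacobi[OF assms, of p] by (simp add: * curvature_def algebra_simps)
qed

text \<open>
Apply \<open>[X, Y] = XY - YX\<close> to the function \<open>g(Z, W)\<close>.
\<close>

lemma curvature_metric_skew:
  assumes [simp]: "X \<in> VF" "Y \<in> VF" "Z \<in> VF" "W \<in> VF"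
  shows "g p (R X Y Z p) (W p) = - g p (Z p) (R X Y W p)"
proof -
  let ?h = "\<lambda>q. g q (Z q) (W q)"
  have second: "dir_deriv A U (dir_deriv A V ?h) p =
     g p (D U (D V Z) p) (W p) + g p (D V Z p) (D U W p) +
     (g p (D U Z p) (D V W p) + g p (Z p) (D U (D V W) p))"
    if [simp]: "U \<in> VF" "V \<in> VF" for U V
  proof -
    have "dir_deriv A V ?h = (\<lambda>q. g q (D V Z q) (W q) + g q (Z q) (D V W q))"
      by (simp add: dir_deriv_metric fun_eq_iff)
    then show ?thesis by (simp add: dir_deriv_fun_add smooth_fun_metric D_field dir_deriv_metric)
  qed
  have "dir_deriv A (br X Y) ?h p = dir_deriv A X (dir_deriv A Y ?h) p - dir_deriv A Y (dir_deriv A X ?h) p"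
    by (simp add: dir_deriv_lie_bracket smooth_fun_metric)
  then show ?thesis
    by (simp add: second dir_deriv_metric lie_bracket_field curvature_def g_simps)
qed

lemma curvature_add_1:
  assumes [simp]: "X \<in> VF" "X' \<in> VF" "Y \<in> VF" "Z \<in> VF"
  shows "R (\<lambda>q. X q + X' q) Y Z p = R X Y Z p + R X' Y Z p"
proof -
  have "br (\<lambda>q. X q + X' q) Y = (\<lambda>p. br X Y p + br X' Y p)"
    by (simp add: lie_bracket_torsion_free vector_fields_add D_add_left D_add_right fun_eq_iff)
  then show ?thesis
    by (simp add: curvature_def D_add_left D_add_right D_field lie_bracket_field)
qed

lemma curvature_scale_1:
  assumes [simp]: "smooth_fun A h" "X \<in> VF" "Y \<in> VF" "Z \<in> VF"
  shows "R (\<lambda>q. h q *\<^sub>R X q) Y Z p = h p *\<^sub>R R X Y Z p"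
proof -
  have "br (\<lambda>q. h q *\<^sub>R X q) Y = (\<lambda>p. h p *\<^sub>R br X Y p - dir_deriv A Y h p *\<^sub>R X p)"
    by (simp add: lie_bracket_torsion_free vector_fields_scaleR D_scale_left D_scale_right fun_eq_iff algebra_simps)
  then show ?thesis
    by (simp add: curvature_def D_scale_left D_scale_right D_diff_left D_field lie_bracket_field
        vector_fields_scaleR smooth_fun_dir_deriv algebra_simps)
qed

lemma curvature_add_3:
  assumes [simp]: "X \<in> VF" "Y \<in> VF" "Z \<in> VF" "Z' \<in> VF"
  shows "R X Y (\<lambda>q. Z q + Z' q) p = R X Y Z p + R X Y Z' p"
  by (simp add: curvature_def D_add_right D_field lie_bracket_field)

text \<open>
The derivatives of \<open>h\<close> add up to $X(Yh) - Y(Xh) - [X,Y]h = 0$.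
\<close>

lemma curvature_scale_3:
  assumes [simp]: "smooth_fun A h" "X \<in> VF" "Y \<in> VF" "Z \<in> VF"
  shows "R X Y (\<lambda>q. h q *\<^sub>R Z q) p = h p *\<^sub>R R X Y Z p"
  by (simp add: curvature_def D_scale_right D_add_right D_field lie_bracket_field
        vector_fields_scaleR vector_fields_add smooth_fun_dir_deriv dir_deriv_lie_bracket algebra_simps)

lemma curvature_add_2:
  assumes [simp]: "X \<in> VF" "Y \<in> VF" "Y' \<in> VF" "Z \<in> VF"
  shows "R X (\<lambda>q. Y q + Y' q) Z p = R X Y Z p + R X Y' Z p"
  by (simp add: curvature_skew[of _ X] vector_fields_add curvature_add_1)

lemma curvature_scale_2:
  assumes [simp]: "smooth_fun A h" "X \<in> VF" "Y \<in> VF" "Z \<in> VF"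
  shows "R X (\<lambda>q. h q *\<^sub>R Y q) Z p = h p *\<^sub>R R X Y Z p"
  by (simp add: curvature_skew[of _ X] vector_fields_scaleR curvature_scale_1)

lemma curvature_depends_on_values:
  assumes X: "X \<in> VF" "X' \<in> VF" "X p = X' p" and Y: "Y \<in> VF" "Y' \<in> VF" "Y p = Y' p"
    and Z: "Z \<in> VF" "Z' \<in> VF" "Z p = Z' p"
  shows "R X Y Z p = R X' Y' Z' p"
proof -
  have "R X Y Z p = R X' Y Z p"
    by (rule tensorial_depends_on_value[of "\<lambda>X. R X Y Z p"])
      (use X Y Z in \<open>auto simp: curvature_add_1 curvature_scale_1\<close>)
  also have "\<dots> = R X' Y' Z p"
    by (rule tensorial_depends_on_value[of "\<lambda>Y. R X' Y Z p"])
      (use X Y Z in \<open>auto simp: curvature_add_2 curvature_scale_2\<close>)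
  also have "\<dots> = R X' Y' Z' p"
    by (rule tensorial_depends_on_value[of "\<lambda>Z. R X' Y' Z p"])
      (use X Y Z in \<open>auto simp: curvature_add_3 curvature_scale_3\<close>)
  finally show ?thesis .
qed

lemma curvature_at_cases:
  obtains X Y Z where "X \<in> VF" "Y \<in> VF" "Z \<in> VF" "X p = x" "Y p = y" "Z p = z"
  by (metis exists_vector_field)

text \<open>
The tensor on tangent vectors is defined by a definite description; tensoriality is precisely the
uniqueness that it needs.
\<close>

lemma curvature_at_eq:
  assumes "X \<in> VF" "Y \<in> VF" "Z \<in> VF"
  shows "curvature_at A D p (X p) (Y p) (Z p) = R X Y Z p"
  unfolding curvature_at_def
proof (rule the_equality)
  show "\<forall>X'\<in>VF. \<forall>Y'\<in>VF. \<forall>Z'\<in>VF. X' p = X p \<and> Y' p = Y p \<and> Z' p = Z p \<longrightarrow> R X' Y' Z' p = R X Y Z p"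
    using curvature_depends_on_values assms by blast
qed (use assms in blast)

lemma algebraic_curvature_at: "algebraic_curvature (g p) (curvature_at A D p)"
proof -
  let ?R = "curvature_at A D p"
  have ext: "\<exists>X\<in>VF. X p = x" for x using exists_vector_field by metis
  show ?thesis
  proof (intro algebraic_curvature.intro inner_product_form_metric algebraic_curvature_axioms.intro)
    fix x y z w
    obtain X Y Z W where VF[simp]: "X \<in> VF" "Y \<in> VF" "Z \<in> VF" "W \<in> VF"
      and val: "x = X p" "y = Y p" "z = Z p" "w = W p"
      using ext by metis
    show "?R y x z = - ?R x y z" unfolding val by (simp add: curvature_at_eq curvature_skew[of X Y])
    show "g p (?R x y z) w = - g p z (?R x y w)"
      unfolding val by (simp add: curvature_at_eq curvature_metric_skew)
    show "?R x y z + ?R y z x + ?R z x y = 0"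
      unfolding val by (simp add: curvature_at_eq curvature_bianchi)
    show "linear (\<lambda>x. ?R x y z)"
    proof (rule linearI)
      fix u v obtain U V where [simp]: "U \<in> VF" "V \<in> VF" and uv: "u = U p" "v = V p" using ext by metis
      show "?R (u + v) y z = ?R u y z + ?R v y z"
        using curvature_at_eq[of "\<lambda>q. U q + V q" Y Z p] curvature_add_1[of U V Y Z p]
        unfolding val uv by (simp add: curvature_at_eq vector_fields_add)
      show "?R (r *\<^sub>R u) y z = r *\<^sub>R ?R u y z" for r
        using curvature_at_eq[of "\<lambda>q. r *\<^sub>R U q" Y Z p] curvature_scale_1[OF smooth_fun_const, of U Y Z r p]
        unfolding val uv by (simp add: curvature_at_eq vector_fields_scaleR smooth_fun_const)
    qed
    show "linear (?R x y)"
    proof (rule linearI)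
      fix u v obtain U V where [simp]: "U \<in> VF" "V \<in> VF" and uv: "u = U p" "v = V p" using ext by metis
      show "?R x y (u + v) = ?R x y u + ?R x y v"
        using curvature_at_eq[of X Y "\<lambda>q. U q + V q" p] curvature_add_3[of X Y U V p]
        unfolding val uv by (simp add: curvature_at_eq vector_fields_add)
      show "?R x y (r *\<^sub>R u) = r *\<^sub>R ?R x y u" for r
        using curvature_at_eq[of X Y "\<lambda>q. r *\<^sub>R U q" p] curvature_scale_3[OF smooth_fun_const, of X Y U r p]
        unfolding val uv by (simp add: curvature_at_eq vector_fields_scaleR smooth_fun_const)
    qed
  qed
qed

lemma ricci_eq_Ric: "ricci A D p x y = algebraic_curvature.Ric (curvature_at A D p) x y"
  by (simp add: ricci_def algebraic_curvature.Ric_def[OF algebraic_curvature_at])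

lemma metric_ricci_sharp: "g p (ricci_sharp A g D p x) y = ricci A D p x y"
proof -
  interpret algebraic_curvature "g p" "curvature_at A D p" by (rule algebraic_curvature_at)
  have "linear (ricci A D p x)" using linear_Ric_right by (simp add: ricci_eq_Ric[abs_def])
  from theI'[OF riesz_representation[OF this]] show ?thesis by (simp add: ricci_sharp_def)
qed

lemma linear_ricci_sharp: "linear (ricci_sharp A g D p)"
proof -
  interpret algebraic_curvature "g p" "curvature_at A D p" by (rule algebraic_curvature_at)
  have lin: "linear (\<lambda>x. ricci A D p x y)" for y
    using linear_Ric_right[of y] by (simp add: ricci_eq_Ric[abs_def] Ric_sym[of _ y])
  show ?thesis
    by (rule linearI; rule nondegenerate)
      (simp_all add: metric_ricci_sharp form_simps linear_add[OF lin] linear_cmul[OF lin])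
qed

lemma metric_trace_orthonormal:
  obtains e where "inner_product_form.orthonormal (g p) e"
    and "\<And>B. metric_trace g B p = (\<Sum>i\<in>UNIV. B p (e i) (e i))"
proof
  interpret inner_product_form "g p" by (rule inner_product_form_metric)
  have "orthonormal_frame_at g p = orthonormal" by (auto simp: orthonormal_frame_at_def orthonormal_def fun_eq_iff)
  then show "orthonormal (SOME e. orthonormal_frame_at g p e)"
    using someI_ex[OF exists_orthonormal] by simp
qed (simp add: metric_trace_def Let_def)

end


section \<open>Weak almost contact metric structures\<close>

context weak_almost_contact_metric
begin

lemma linear_f: "linear (f p)" and linear_Q: "linear (Q p)" and linear_eta: "linear (\<eta> p)"
  using f_tensor Q_tensor eta_form by (auto simp: tensor_11_def one_form_def)

lemma Q_injective: "Q p u = 0 \<Longrightarrow> u = 0" and Q_surjective: "\<exists>u. Q p u = w"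
proof -
  obtain B where B: "matrix (Q p) ** B = mat 1" "B ** matrix (Q p) = mat 1"
    using Q_nonsingular by (auto simp: invertible_def)
  have Q: "matrix (Q p) *v v = Q p v" for v
    using matrix_works[of "Q p"] linear_Q by (simp add: linear_matrix_vector_mul_eq)
  show "u = 0" if "Q p u = 0"
    using that B(2) Q[of u] by (metis matrix_vector_mul_assoc matrix_vector_mul_lid matrix_vector_mult_0_right)
  show "\<exists>u. Q p u = w"
    using B(1) Q by (metis matrix_vector_mul_assoc matrix_vector_mul_lid)
qed

text \<open>
As $f^2\xi = 0$, the number $a = \eta(f\xi)$ satisfies $a^2 = 0$, by invariance of the kernel of
\<open>\<eta>\<close>.  Then $0 = f^2(f\xi) = -Qf\xi$, and \<open>Q\<close> is nonsingular.
\<close>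

lemma f_xi: "f p (\<xi> p) = 0"
proof -
  have ff: "f p (f p (\<xi> p)) = 0" by (simp add: f_squared Q_xi eta_xi)
  let ?a = "\<eta> p (f p (\<xi> p))"
  have "\<eta> p (f p (\<xi> p) - ?a *\<^sub>R \<xi> p) = 0"
    by (simp add: linear_diff[OF linear_eta] linear_cmul[OF linear_eta] eta_xi)
  then have "\<eta> p (f p (f p (\<xi> p) - ?a *\<^sub>R \<xi> p)) = 0" by (rule ker_eta_invariant)
  then have "?a * ?a = 0"
    by (simp add: linear_diff[OF linear_f] linear_cmul[OF linear_f] ff linear_diff[OF linear_eta]
        linear_cmul[OF linear_eta] linear_0[OF linear_eta] linear_neg[OF linear_eta])
  then have "Q p (f p (\<xi> p)) = 0"
    using f_squared[of p "f p (\<xi> p)"] by (simp add: ff linear_0[OF linear_f])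
  then show ?thesis by (rule Q_injective)
qed

lemma eta_f [simp]: "\<eta> p (f p v) = 0"
proof -
  have "\<eta> p (v - \<eta> p v *\<^sub>R \<xi> p) = 0"
    by (simp add: linear_diff[OF linear_eta] linear_cmul[OF linear_eta] eta_xi)
  from ker_eta_invariant[OF this] show ?thesis
    by (simp add: linear_diff[OF linear_f] linear_cmul[OF linear_f] f_xi)
qed

lemma inner_product_form_g: "inner_product_form (g p)"
  using metric by (rule riemannian_metric_inner_product_form)

lemma eta_eq: "\<eta> p v = g p (\<xi> p) v"
  using f_metric[of p v "\<xi> p"] inner_product_form.sym[OF inner_product_form_g, of p v "\<xi> p"]
  by (simp add: f_xi Q_xi eta_xi inner_product_form.form_simps[OF inner_product_form_g])

lemma Q_self_adjoint: "g p (Q p v) w = g p v (Q p w)"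
  using f_metric[of p v w] f_metric[of p w v] inner_product_form.sym[OF inner_product_form_g] by (metis add.commute diff_add_cancel mult.commute)

lemma f_Q_commute: "f p (Q p v) = Q p (f p v)"
proof -
  have "f p (f p (f p v)) = - f p (Q p v)"
    by (simp add: f_squared[of p v] linear_add[OF linear_f] linear_diff[OF linear_f] linear_neg[OF linear_f]
        linear_cmul[OF linear_f] f_xi)
  moreover have "f p (f p (f p v)) = - Q p (f p v)" by (simp add: f_squared[of p "f p v"])
  ultimately show ?thesis by simp
qed

text \<open>
The compatibility of \<open>f\<close> with the metric only concerns pairs \<open>f v\<close>, \<open>f u\<close>.  By surjectivity of \<open>Q\<close> every
vector is of the form $-f^2u + \eta(u)\xi$, which reduces the general case to such pairs.
\<close>

lemma f_skew: "g p (f p v) w = - g p v (f p w)"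
proof -
  interpret inner_product_form "g p" by (rule inner_product_form_g)
  obtain u where u: "w = Q p u" using Q_surjective by metis
  have w: "w = - f p (f p u) + \<eta> p u *\<^sub>R \<xi> p" by (simp add: u f_squared)
  have "g p (f p v) (\<xi> p) = 0" using eta_f[of p v] by (simp add: eta_eq sym)
  then have "g p (f p v) w = - g p (f p v) (f p (f p u))"
    by (subst w) (simp add: form_simps)
  also have "\<dots> = - g p v (Q p (f p u))" by (simp add: f_metric)
  also have "\<dots> = - g p v (f p w)" by (simp add: u f_Q_commute)
  finally show ?thesis .
qed

lemma f_kernel:
  assumes "f p u = 0"
  shows "u = \<eta> p u *\<^sub>R \<xi> p"
proof -
  have "Q p u = \<eta> p u *\<^sub>R \<xi> p"
    using f_squared[of p u] assms by (simp add: linear_0[OF linear_f])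
  then have "Q p (u - \<eta> p u *\<^sub>R \<xi> p) = 0"
    by (simp add: linear_diff[OF linear_Q] linear_cmul[OF linear_Q] Q_xi)
  from Q_injective[OF this] show ?thesis by simp
qed

end


section \<open>Weak Kenmotsu structures\<close>

sublocale weak_beta_kenmotsu \<subseteq> levi_civita_manifold A g D
  by unfold_locales (rule metric connection)+

context weak_beta_kenmotsu
begin

text \<open>
The structure equation for \<open>Y = \<xi>\<close> determines $\nabla_X\xi$ modulo the kernel of \<open>f\<close>, that is, modulo \<open>\<xi>\<close>.
The remaining component vanishes because \<open>\<xi>\<close> has constant length.
\<close>

lemma D_xi:
  assumes [simp]: "X \<in> VF"
  shows "D X \<xi> p = \<beta> *\<^sub>R (X p - \<eta> p (X p) *\<^sub>R \<xi> p)"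
proof -
  have "D X (\<lambda>q. f q (\<xi> q)) = (\<lambda>q. 0)"
    using D_scale_right[OF assms assms smooth_fun_const[of 0]] by (simp add: f_xi)
  then have "f p (D X \<xi> p) = \<beta> *\<^sub>R f p (X p)"
    using kenmotsu[OF assms xi_field, of p]
    by (simp add: eta_xi g_sym[of p _ "\<xi> p"] eta_eq[symmetric])
  then have "f p (D X \<xi> p - \<beta> *\<^sub>R X p) = 0"
    by (simp add: linear_diff[OF linear_f] linear_cmul[OF linear_f])
  from f_kernel[OF this]
  have 1: "D X \<xi> p - \<beta> *\<^sub>R X p = \<eta> p (D X \<xi> p - \<beta> *\<^sub>R X p) *\<^sub>R \<xi> p" .
  have "g q (\<xi> q) (\<xi> q) = 1" for q using eta_xi[of q] by (simp add: eta_eq)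
  then have "\<eta> p (D X \<xi> p) = 0"
    using dir_deriv_metric[OF assms xi_field xi_field, of p] g_sym[of p "\<xi> p"] by (simp add: eta_eq)
  with 1 have "D X \<xi> p - \<beta> *\<^sub>R X p = (- (\<beta> * \<eta> p (X p))) *\<^sub>R \<xi> p"
    by (simp add: linear_diff[OF linear_eta] linear_cmul[OF linear_eta])
  then show ?thesis by (simp add: algebra_simps)
qed

text \<open>
Differentiate the structure equation along a second field.  In the commutator all terms with \<open>\<xi>\<close> or \<open>\<eta>\<close>
cancel, as they are symmetric in \<open>X\<close> and \<open>Y\<close> or occur with both signs.
\<close>

lemma ricci_identity_f:
  assumes [simp]: "X \<in> VF" "Y \<in> VF" "Z \<in> VF"
  shows "R X Y (\<lambda>q. f q (Z q)) p = f p (R X Y Z p) + \<beta>\<^sup>2 *\<^sub>R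
    (g p (f p (Y p)) (Z p) *\<^sub>R X p - g p (f p (X p)) (Z p) *\<^sub>R Y p
     - g p (X p) (Z p) *\<^sub>R f p (Y p) + g p (Y p) (Z p) *\<^sub>R f p (X p))"
proof -
  let ?F = "\<lambda>W q. f q (W q)"
  have F [simp]: "?F W \<in> VF" if "W \<in> VF" for W using f_tensor that by (simp add: tensor_11_def)
  note [simp] = xi_field D_field lie_bracket_field
  have first: "D U (?F W) q = f q (D U W q) + (\<beta> * g q (f q (U q)) (W q)) *\<^sub>R \<xi> q
      + (- \<beta> * g q (\<xi> q) (W q)) *\<^sub>R f q (U q)" if "U \<in> VF" "W \<in> VF" for U W q
    using kenmotsu[OF that, of q] by (simp add: eta_eq algebra_simps)
  \<comment> \<open>\<open>D U (?F V)\<close> is left unexpanded, so that \<open>first\<close> also applies to it in the final simplification\<close>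
  have second: "D U (D V (?F Z)) p = f p (D U (D V Z) p)
      + (\<beta> * g p (f p (U p)) (D V Z p)) *\<^sub>R \<xi> p - (\<beta> * g p (\<xi> p) (D V Z p)) *\<^sub>R f p (U p)
      + (\<beta> * (g p (D U (?F V) p) (Z p) + g p (f p (V p)) (D U Z p))) *\<^sub>R \<xi> p
      + (\<beta> * g p (f p (V p)) (Z p)) *\<^sub>R D U \<xi> p
      - (\<beta> * (g p (D U \<xi> p) (Z p) + g p (\<xi> p) (D U Z p))) *\<^sub>R f p (V p)
      - (\<beta> * g p (\<xi> p) (Z p)) *\<^sub>R D U (?F V) p"
    if [simp]: "U \<in> VF" "V \<in> VF" for U V
  proof -
    note [simp] = smooth_fun_mult[OF smooth_fun_const smooth_fun_metric] smooth_fun_metric smooth_fun_const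
    have "D V (?F Z) = (\<lambda>q. (f q (D V Z q) + (\<beta> * g q (f q (V q)) (Z q)) *\<^sub>R \<xi> q)
        - (\<beta> * g q (\<xi> q) (Z q)) *\<^sub>R f q (V q))"
      by (rule ext) (simp add: first)
    then have "D U (D V (?F Z)) p = D U (?F (D V Z)) p
        + (dir_deriv A U (\<lambda>q. \<beta> * g q (f q (V q)) (Z q)) p *\<^sub>R \<xi> p + (\<beta> * g p (f p (V p)) (Z p)) *\<^sub>R D U \<xi> p)
        - (dir_deriv A U (\<lambda>q. \<beta> * g q (\<xi> q) (Z q)) p *\<^sub>R f p (V p) + (\<beta> * g p (\<xi> p) (Z p)) *\<^sub>R D U (?F V) p)"
      by (simp add: D_add_right D_diff_right D_scale_right vector_fields_add vector_fields_scaleR)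
    then show ?thesis
      by (simp add: first dir_deriv_mult dir_deriv_metric algebra_simps)
  qed
  have br: "br X Y p = D X Y p - D Y X p" by (simp add: lie_bracket_torsion_free)
  note lin = linear_add[OF linear_f] linear_diff[OF linear_f] linear_cmul[OF linear_f] linear_neg[OF linear_f]
  have gxf: "g p (\<xi> p) (f p v) = 0" "g p (f p v) (\<xi> p) = 0" for v
    using eta_f[of p v] g_sym[of p "\<xi> p"] by (simp_all add: eta_eq)
  show ?thesis
    unfolding curvature_def
    by (simp add: second first D_xi br lin g_simps eta_eq gxf g_sym[of p "Y p" "X p"] algebra_simps power2_eq_square)
qed

lemma star_ricci_eq:
  "star_ricci A D f p x y = ricci A D p x (Q p y) +
     \<beta>\<^sup>2 * ((2 * real n - 1) * g p x (Q p y) + \<eta> p x * \<eta> p y)"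
proof -
  interpret algebraic_curvature "g p" "curvature_at A D p" by (rule algebraic_curvature_at)
  have identity: "curvature_at A D p x y (f p z) = f p (curvature_at A D p x y z) + \<beta>\<^sup>2 *\<^sub>R
    (g p (f p y) z *\<^sub>R x - g p (f p x) z *\<^sub>R y - g p x z *\<^sub>R f p y + g p y z *\<^sub>R f p x)" for x y z
  proof -
    obtain X Y Z where VF: "X \<in> VF" "Y \<in> VF" "Z \<in> VF" and val: "X p = x" "Y p = y" "Z p = z"
      by (rule curvature_at_cases)
    \<comment> \<open>the pointwise identity follows by extending \<open>x\<close>, \<open>y\<close>, \<open>z\<close> to vector fields\<close>
    have "(\<lambda>q. f q (Z q)) \<in> VF" using f_tensor VF by (simp add: tensor_11_def)
    then have "curvature_at A D p (X p) (Y p) (f p (Z p)) = R X Y (\<lambda>q. f q (Z q)) p"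
      using curvature_at_eq[of X Y "\<lambda>q. f q (Z q)" p] VF by simp
    also have "\<dots> = f p (R X Y Z p) + \<beta>\<^sup>2 *\<^sub>R
    (g p (f p (Y p)) (Z p) *\<^sub>R X p - g p (f p (X p)) (Z p) *\<^sub>R Y p
     - g p (X p) (Z p) *\<^sub>R f p (Y p) + g p (Y p) (Z p) *\<^sub>R f p (X p))"
      by (rule ricci_identity_f[OF VF])
    finally show ?thesis
      using curvature_at_eq[OF VF, of p] by (simp add: val)
  qed
  have kernel: "u = g p (\<xi> p) u *\<^sub>R \<xi> p" if "f p u = 0" for u
    using f_kernel[OF that] by (simp add: eta_eq)
  have "1 / 2 * endo_trace (\<lambda>z. curvature_at A D p x (f p y) (f p z)) =
    Ric x (Q p y) + \<beta>\<^sup>2 * ((real CARD('k) - 2) * g p x (Q p y) + g p (\<xi> p) x * g p (\<xi> p) y)"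
    by (rule half_trace_star[OF linear_f f_skew identity f_xi kernel])
      (use f_squared eta_xi in \<open>auto simp: eta_eq\<close>)
  then show ?thesis by (simp add: star_ricci_def ricci_eq_Ric eta_eq dimension)
qed

lemma star_scalar_eq:
  "star_scalar A g D f p = endo_trace (\<lambda>v. Q p (ricci_sharp A g D p v)) +
     \<beta>\<^sup>2 * (4 * (real n)\<^sup>2 + (2 * real n - 1) * endo_trace (\<lambda>v. Q p v - v))"
proof -
  interpret inner_product_form "g p" by (rule inner_product_form_g)
  obtain e where e: "orthonormal e" and tr: "\<And>B. metric_trace g B p = (\<Sum>i\<in>UNIV. B p (e i) (e i))"
    using metric_trace_orthonormal by blast
  have "endo_trace (\<lambda>v. Q p (ricci_sharp A g D p v)) = (\<Sum>i\<in>UNIV. g p (Q p (ricci_sharp A g D p (e i))) (e i))"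
    using linear_compose[OF linear_ricci_sharp linear_Q, of p p]
    by (intro endo_trace_orthonormal[OF e]) (simp add: comp_def)
  then have 1: "endo_trace (\<lambda>v. Q p (ricci_sharp A g D p v)) = (\<Sum>i\<in>UNIV. ricci A D p (e i) (Q p (e i)))"
    by (simp add: Q_self_adjoint metric_ricci_sharp)
  have 2: "(\<Sum>i\<in>UNIV. g p (e i) (Q p (e i))) = endo_trace (Q p)"
    by (simp add: endo_trace_orthonormal[OF e linear_Q] Q_self_adjoint)
  have 3: "(\<Sum>i\<in>UNIV. \<eta> p (e i) * \<eta> p (e i)) = 1"
    using orthonormal_parseval[OF e, of "\<xi> p" "\<xi> p"] eta_xi[of p] by (simp add: eta_eq)
  have 4: "endo_trace (\<lambda>v. Q p v - v) = endo_trace (Q p) - (2 * real n + 1)"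
    by (simp add: endo_trace_diff endo_trace_ident dimension)
  have "star_scalar A g D f p = (\<Sum>i\<in>UNIV. ricci A D p (e i) (Q p (e i))) +
      \<beta>\<^sup>2 * ((2 * real n - 1) * (\<Sum>i\<in>UNIV. g p (e i) (Q p (e i))) + (\<Sum>i\<in>UNIV. \<eta> p (e i) * \<eta> p (e i)))"
    by (simp add: star_scalar_def tr star_ricci_eq sum.distrib flip: sum_distrib_left)
  also have "\<dots> = endo_trace (\<lambda>v. Q p (ricci_sharp A g D p v)) +
     \<beta>\<^sup>2 * (4 * (real n)\<^sup>2 + (2 * real n - 1) * endo_trace (\<lambda>v. Q p v - v))"
    unfolding 1 2 3 4 by (simp add: algebra_simps power2_eq_square)
  finally show ?thesis .
qed

end

theorem theorem1:
  fixes A :: "('m::{t2_space, second_countable_topology}, 'k::finite) chart set"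
    and n :: nat
    and f Q :: "'m \<Rightarrow> real ^ 'k \<Rightarrow> real ^ 'k"
    and \<xi> :: "'m \<Rightarrow> real ^ 'k"
    and \<eta> :: "'m \<Rightarrow> real ^ 'k \<Rightarrow> real"
    and g :: "'m \<Rightarrow> real ^ 'k \<Rightarrow> real ^ 'k \<Rightarrow> real"
    and D :: "('m \<Rightarrow> real ^ 'k) \<Rightarrow> ('m \<Rightarrow> real ^ 'k) \<Rightarrow> 'm \<Rightarrow> real ^ 'k"
    and \<beta> :: real
  assumes "weak_beta_kenmotsu A n f Q \<xi> \<eta> g D \<beta>"
  shows "(\<forall>X\<in>vector_fields A. \<forall>Y\<in>vector_fields A. \<forall>p.
            star_ricci A D f p (X p) (Y p) =
              ricci A D p (X p) (Q p (Y p)) +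
              \<beta>\<^sup>2 * ((2 * real n - 1) * g p (X p) (Q p (Y p)) + \<eta> p (X p) * \<eta> p (Y p))) \<and>
         (\<forall>p. star_scalar A g D f p =
            endo_trace (\<lambda>v. Q p (ricci_sharp A g D p v)) +
            \<beta>\<^sup>2 * (4 * (real n)\<^sup>2 + (2 * real n - 1) * endo_trace (\<lambda>v. Q p v - v)))"
proof -
  interpret weak_beta_kenmotsu A n f Q \<xi> \<eta> g D \<beta> by (rule assms)
  show ?thesis using star_ricci_eq star_scalar_eq by blast
qed

end
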